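(* The \textsc{Spectrum Connectivity} problem restricted to cognitive radio networks whose potential graph is complete is fixed-parameter tractable when parameterized by the number $k$ of channels, i.e. it can be solved in time $f(k)\cdot n^{O(1)}$ for some computable function $f$, where $n$ is the number of SUs.
   Context: A cognitive radio network consists of: a finite set $U$ of secondary users (SUs), $n=|U|$; a finite set $C$ of channels, $k=|C|$; for each $u\in U$ a spectrum map $\textsc{SpecMap}(u)\subseteq C$; a simple undirected graph $\mathcal{PG}=(U,E)$ called the potential graph; and for each $u\in U$ a positive integer antenna budget $\beta(u)$. A spectrum assignment is a function $\mathcal{SA}:U\to 2^C$ with $\mathcal{SA}(u)\subseteq \textsc{SpecMap}(u)$ and $|\mathcal{SA}(u)|\le\beta(u)$ for all $u$. A potential edge $\{u,v\}\in E$ is realized under $\mathcal{SA}$ if $\mathcal{SA}(u)\cap\mathcal{SA}(v)\neq\emptyset$; the realization graph is $(U,E')$ where $E'$ is the set of realized edges. The network is connectable if some spectrum assignment makes the realization graph connected. The \textsc{Spectrum Connectivity} problem is to decide whether a given cognitive radio network is connectable. *)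

theory Defs
  imports "Graph_Theory.Graph_Theory"
begin

section \<open>Cognitive radio networks\<close>

text \<open>As usual in \<^theory>\<open>Graph_Theory.Digraph\<close>, a simple undirected graph is a finite
  symmetric loop-free digraph without parallel arcs (\<^locale>\<open>pair_graph\<close>): the edge
  \<open>{u, v}\<close> is the pair of arcs \<open>(u, v)\<close>, \<open>(v, u)\<close>. The secondary users are
  the vertices of the potential graph.\<close>

record ('u, 'c) network =
  PG :: "'u pair_pre_digraph"
  channels :: "'c set"
  SpecMap :: "'u \<Rightarrow> 'c set"
  budget :: "'u \<Rightarrow> nat"

abbreviation users :: "('u, 'c) network \<Rightarrow> 'u set" where
  "users N \<equiv> pverts (PG N)"

definition cognitive_radio_network :: "('u, 'c) network \<Rightarrow> bool" where
  "cognitive_radio_network N \<longleftrightarrow>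
     pair_graph (PG N) \<and> finite (channels N) \<and>
     (\<forall>u\<in>users N. SpecMap N u \<subseteq> channels N \<and> 0 < budget N u)"

definition spectrum_assignment :: "('u, 'c) network \<Rightarrow> ('u \<Rightarrow> 'c set) \<Rightarrow> bool" where
  "spectrum_assignment N SA \<longleftrightarrow>
     (\<forall>u\<in>users N. SA u \<subseteq> SpecMap N u \<and> card (SA u) \<le> budget N u)"

definition realization_graph ::
    "('u, 'c) network \<Rightarrow> ('u \<Rightarrow> 'c set) \<Rightarrow> 'u pair_pre_digraph" where
  "realization_graph N SA =
     \<lparr> pverts = users N, parcs = {(u, v) \<in> parcs (PG N). SA u \<inter> SA v \<noteq> {}} \<rparr>"

definition connectable :: "('u, 'c) network \<Rightarrow> bool" where
  "connectable N \<longleftrightarrow>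
     (\<exists>SA. spectrum_assignment N SA \<and>
           Digraph_Component.connected (with_proj (realization_graph N SA)))"

definition complete_potential_graph :: "('u, 'c) network \<Rightarrow> bool" where
  "complete_potential_graph N \<longleftrightarrow>
     complete_digraph (card (users N)) (with_proj (PG N))"

section \<open>Random access machines\<close>

text \<open>The uniform-cost RAM of Cook and Reckhow over the natural numbers, with a read-only
  input tape that is consumed from left to right. There is no multiplication, so uniform
  cost is polynomially related to Turing machine time. Subtraction is truncated.\<close>

datatype instr =
    Const nat nat      \<comment> \<open>\<open>X\<^sub>i := c\<close>\<close>
  | Add nat nat nat    \<comment> \<open>\<open>X\<^sub>i := X\<^sub>j + X\<^sub>l\<close>\<close>
  | Sub nat nat nat    \<comment> \<open>\<open>X\<^sub>i := X\<^sub>j - X\<^sub>l\<close>\<close>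
  | Load nat nat       \<comment> \<open>\<open>X\<^sub>i := X\<^bsub>X\<^sub>j\<^esub>\<close>\<close>
  | Store nat nat      \<comment> \<open>\<open>X\<^bsub>X\<^sub>i\<^esub> := X\<^sub>j\<close>\<close>
  | Jump_pos nat nat   \<comment> \<open>go to instruction \<open>a\<close> if \<open>X\<^sub>j > 0\<close>\<close>
  | Read nat           \<comment> \<open>\<open>X\<^sub>i :=\<close> next input number, or \<open>0\<close> if there is none\<close>

type_synonym config = "nat \<times> (nat \<Rightarrow> nat) \<times> nat list"
  \<comment> \<open>program counter, registers, unread input\<close>

fun exec :: "instr \<Rightarrow> config \<Rightarrow> config" where
  "exec (Const i c) (pc, X, inp) = (Suc pc, X(i := c), inp)"
| "exec (Add i j l) (pc, X, inp) = (Suc pc, X(i := X j + X l), inp)"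
| "exec (Sub i j l) (pc, X, inp) = (Suc pc, X(i := X j - X l), inp)"
| "exec (Load i j) (pc, X, inp) = (Suc pc, X(i := X (X j)), inp)"
| "exec (Store i j) (pc, X, inp) = (Suc pc, X(X i := X j), inp)"
| "exec (Jump_pos j a) (pc, X, inp) = (if X j > 0 then a else Suc pc, X, inp)"
| "exec (Read i) (pc, X, []) = (Suc pc, X(i := 0), [])"
| "exec (Read i) (pc, X, x # inp) = (Suc pc, X(i := x), inp)"

definition halted :: "instr list \<Rightarrow> config \<Rightarrow> bool" where
  "halted P cfg \<longleftrightarrow> length P \<le> fst cfg"

definition step :: "instr list \<Rightarrow> config \<Rightarrow> config" where
  "step P cfg = (if halted P cfg then cfg else exec (P ! fst cfg) cfg)"

definition initial :: "nat list \<Rightarrow> config" where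
  "initial inp = (0, (\<lambda>_. 0), inp)"

text \<open>Halted configurations are fixed points of \<^const>\<open>step\<close>, so the following says that
  \<open>P\<close> halts on \<open>inp\<close> after at most \<open>t\<close> steps with result \<open>y\<close> in register \<open>0\<close>.\<close>

definition outputs_within :: "instr list \<Rightarrow> nat list \<Rightarrow> nat \<Rightarrow> nat \<Rightarrow> bool" where
  "outputs_within P inp t y \<longleftrightarrow>
     (let cfg = (step P ^^ t) (initial inp) in halted P cfg \<and> fst (snd cfg) 0 = y)"

definition computable :: "(nat \<Rightarrow> nat) \<Rightarrow> bool" where
  "computable f \<longleftrightarrow> (\<exists>P. \<forall>x. \<exists>t. outputs_within P [x] t (f x))"

section \<open>Fixed-parameter tractability\<close>

text \<open>\<open>I\<close> is the set of instances, \<open>Y x\<close> says that \<open>x\<close> is a yes-instance, \<open>enc x w\<close> that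
  \<open>w\<close> is an encoding of \<open>x\<close>, \<open>\<kappa>\<close> is the parameter and \<open>sz\<close> the size measure in which the
  running time is polynomial. The maximum with \<open>1\<close> only matters for size \<open>0\<close>, where
  \<open>0 ^ c\<close> would allow no step at all.\<close>

definition fixed_parameter_tractable ::
    "'i set \<Rightarrow> ('i \<Rightarrow> bool) \<Rightarrow> ('i \<Rightarrow> nat list \<Rightarrow> bool) \<Rightarrow> ('i \<Rightarrow> nat) \<Rightarrow> ('i \<Rightarrow> nat) \<Rightarrow> bool" where
  "fixed_parameter_tractable I Y enc \<kappa> sz \<longleftrightarrow>
     (\<exists>P f c. computable f \<and>
        (\<forall>x\<in>I. \<forall>w. enc x w \<longrightarrow>
           outputs_within P w (f (\<kappa> x) * max 1 (sz x) ^ c) (if Y x then 1 else 0)))"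

text \<open>A network is presented along arbitrary enumerations of its users and channels: the
  numbers of users and channels; for each user its antenna budget followed by the
  characteristic vector of its spectrum map; and the adjacency matrix of the potential graph.\<close>

definition network_code ::
    "'u list \<Rightarrow> 'c list \<Rightarrow> ('u, 'c) network \<Rightarrow> nat list" where
  "network_code us cs N =
     [length us, length cs] @
     concat (map (\<lambda>u. budget N u # map (\<lambda>c. if c \<in> SpecMap N u then 1 else 0) cs) us) @
     concat (map (\<lambda>u. map (\<lambda>v. if (u, v) \<in> parcs (PG N) then 1 else 0) us) us)"

definition encodes_network :: "('u, 'c) network \<Rightarrow> nat list \<Rightarrow> bool" where
  "encodes_network N w \<longleftrightarrow>
     (\<exists>us cs. distinct us \<and> set us = users N \<and> distinct cs \<and> set cs = channels N \<and>
              w = network_code us cs N)"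

end

theory Submission
  imports Defs "HOL-Library.Nat_Bijection"
begin

text \<open>On a complete potential graph, users with the same nonempty channel set are adjacent, so
  whether a spectrum assignment connects at least two users depends only on the family of sets it
  uses. With \<open>k\<close> channels there are at most \<open>2 ^ 2 ^ k\<close> families. Reading the users one by one, a
  machine maintains the set of all families that can be realized so far, coded as a number below
  \<open>2 ^ 2 ^ 2 ^ k\<close>; budgets can be capped at \<open>k\<close>. Hence there are only finitely many
  transitions for each \<open>k\<close>. They are primitive recursive, and so is the running time of a compiled
  primitive recursive function; summing it over all transitions gives the computable factor
  of \<open>k\<close>, and the total time is linear in the number of users.\<close>

section \<open>Programming the random access machine\<close>

text \<open>Time is measured against the number of users, while budgets are arbitrary numbers and
  the adjacency matrix has quadratic length. The cap on budgets, and halting before the matrix is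
  read, keep the work per user a function of \<open>k\<close> alone. One program has to serve every
  \<open>k\<close>, so each transition is recomputed by compiled code instead of being looked up in
  a table. The factor of \<open>k\<close> must itself be computable on the same machine model; this
  is why derivations carry exact running times: the cost of a compiled function is again compilable,
  and a sum of costs is a bound that needs no explicit estimate. States are sets of families rather
  than families because each user's choice of channels is nondeterministic: this is the subset
  construction for an automaton that guesses one assignment. Below two users the family does not
  decide: a single user is connected even without channels, and the empty graph is not connected.
  Hence the number of users, capped at 2, is carried alongside.\<close>

fun reloc :: "nat \<Rightarrow> instr \<Rightarrow> instr" where
  "reloc a (Jump_pos j b) = Jump_pos j (a + b)"
| "reloc a i = i"

lemma reloc_reloc [simp]: "reloc a (reloc b i) = reloc (a + b) i"
  by (cases i) auto

lemma reloc_0 [simp]: "reloc 0 = id"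
proof
  fix i show "reloc 0 i = id i"
    by (cases i) auto
qed

lemma funpow_trans:
  assumes "(f ^^ a) x = y" "(f ^^ b) y = z" "n = b + a"
  shows "(f ^^ n) x = z"
  using assms by (simp add: funpow_add)

text \<open>A code fragment has jump targets relative to its own start. In \<open>runs\<close> the fragment is
  placed anywhere in a program and control leaves it at its end.\<close>

definition runs ::
    "instr list \<Rightarrow> (nat \<Rightarrow> nat) \<Rightarrow> nat list \<Rightarrow> nat \<Rightarrow> (nat \<Rightarrow> nat) \<Rightarrow> nat list \<Rightarrow> bool" where
  "runs c X w t X' w' \<longleftrightarrow>
     (\<forall>p q. (step (p @ map (reloc (length p)) c @ q) ^^ t) (length p, X, w) =
        (length p + length c, X', w'))"

lemma runs_eq:
  "runs c X w t Y v \<Longrightarrow> t = t' \<Longrightarrow> Y = Y' \<Longrightarrow> runs c X w t' Y' v"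
  by simp

definition seq :: "instr list \<Rightarrow> instr list \<Rightarrow> instr list" (infixr \<open>;;\<close> 65) where
  "c ;; d = c @ map (reloc (length c)) d"

lemma length_seq [simp]: "length (c ;; d) = length c + length d"
  by (simp add: seq_def)

lemma runs_seq:
  assumes "runs c X w t X' w'" "runs d X' w' u X'' w''"
  shows "runs (c ;; d) X w (t + u) X'' w''"
  unfolding runs_def
proof (intro allI)
  fix p q
  let ?P = "p @ map (reloc (length p)) (c ;; d) @ q"
  have 1: "?P = p @ map (reloc (length p)) c @ (map (reloc (length p + length c)) d @ q)"
    by (simp add: seq_def o_def)
  have 2: "?P = (p @ map (reloc (length p)) c) @
      map (reloc (length (p @ map (reloc (length p)) c))) d @ q"
    by (simp add: seq_def o_def)
  have "(step ?P ^^ t) (length p, X, w) = (length p + length c, X', w')"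
    using assms(1) unfolding runs_def 1 by blast
  moreover have "(step ?P ^^ u) (length p + length c, X', w') =
      (length p + length (c ;; d), X'', w'')"
    using assms(2)[unfolded runs_def, rule_format, of "p @ map (reloc (length p)) c" q]
    unfolding 2[symmetric] by (simp add: add.assoc)
  ultimately show "(step ?P ^^ (t + u)) (length p, X, w) = (length p + length (c ;; d), X'', w'')"
    by (simp add: funpow_add add.commute[of t u])
qed

lemma step_at:
  "step (p @ i # q) (length p, X, w) = exec i (length p, X, w)"
  by (simp add: step_def halted_def)

lemma step_eq:
  assumes "P = p @ i # q" "a = length p"
  shows "step P (a, X, w) = exec i (a, X, w)"
  using assms step_at by simp

lemma runs_single:
  assumes "\<And>a. exec (reloc a i) (a, X, w) = (Suc a, X', w')"
  shows "runs [i] X w 1 X' w'"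
  using assms by (simp add: runs_def step_at)

lemma runs_Const: "runs [Const i c] X w 1 (X(i := c)) w"
  and runs_Add: "runs [Add i j l] X w 1 (X(i := X j + X l)) w"
  and runs_Sub: "runs [Sub i j l] X w 1 (X(i := X j - X l)) w"
  and runs_Read: "runs [Read i] X (x # w) 1 (X(i := x)) w"
  by (rule runs_single; simp)+

text \<open>There is no direct copy instruction, so the source is added to a zeroed register 0. The
  source must therefore not be register 0; the target may be.\<close>

definition move :: "nat \<Rightarrow> nat \<Rightarrow> instr list" where
  "move i j = [Const 0 0] ;; [Add i j 0]"

lemma runs_move:
  assumes "0 < j"
  shows "runs (move i j) X w 2 (X(0 := 0, i := X j)) w"
  using runs_seq[OF runs_Const[of 0 0 X w] runs_Add[of i j 0]] assms
  by (simp add: move_def numeral_2_eq_2)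

text \<open>The test stands at the end, at offset \<open>length c + 4\<close>, and is entered by a
  jump made unconditional by setting register 0 to 1. The counter is decremented before
  \<open>c\<close> runs, so \<open>c\<close> sees the number of rounds still to come.\<close>

definition loop :: "nat \<Rightarrow> instr list \<Rightarrow> instr list" where
  "loop r c = [Const 0 1, Jump_pos 0 (length c + 4)] @
     map (reloc 2) ([Const 0 1] ;; [Sub r r 0] ;; c) @ [Jump_pos r 2]"

lemma length_loop [simp]: "length (loop r c) = length c + 5"
  by (simp add: loop_def)

text \<open>\<open>I j\<close> describes the state at the test after \<open>j\<close> rounds. The
  leading 3 counts the two entry instructions and the failing last test; the 3 in each round counts
  the two instructions of the decrement and the jump back.\<close>

lemma runs_loop:
  assumes "0 < r" "I 0 (X(0 := 1)) w"
    and inv: "\<And>j X w. j \<le> m \<Longrightarrow> I j X w \<Longrightarrow> X r = m - j"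
    and body: "\<And>j X w. j < m \<Longrightarrow> I j X w \<Longrightarrow>
      \<exists>X' w'. runs c (X(0 := 1, r := m - Suc j)) w (t j) X' w' \<and> I (Suc j) X' w'"
  shows "\<exists>X' w'. runs (loop r c) X w (3 + (\<Sum>j<m. t j + 3)) X' w' \<and> I m X' w'"
proof -
  define B where "B = [Const 0 1] ;; [Sub r r 0] ;; c"
  have lenB: "length B = length c + 2"
    by (simp add: B_def)
  have body': "\<exists>X' w'. runs B X w (t j + 2) X' w' \<and> I (Suc j) X' w'" if "j < m" "I j X w" for j X w
  proof -
    obtain X' w' where X': "runs c (X(0 := 1, r := m - Suc j)) w (t j) X' w'" "I (Suc j) X' w'"
      using body \<open>j < m\<close> \<open>I j X w\<close> by blast
    have "X r - 1 = m - Suc j"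
      using inv[of j X w] that by simp
    then have "runs ([Sub r r 0] ;; c) (X(0 := 1)) w (1 + t j) X' w'"
      using runs_seq[OF runs_Sub[of r r 0 "X(0 := 1)" w]] X'(1) \<open>0 < r\<close> by simp
    then have "runs B X w (1 + (1 + t j)) X' w'"
      unfolding B_def by (rule runs_seq[OF runs_Const])
    then show ?thesis
      using X'(2) by (auto simp: add.commute)
  qed
  \<comment> \<open>Recording the state at the closing test rather than at the start of the body
    covers the case of no rounds. In the sum the upper bound is the outer \<open>j\<close>.\<close>
  have steps: "\<exists>Y v. I j Y v \<and> (\<forall>p q. (step (p @ map (reloc (length p)) (loop r c) @ q) ^^
        (2 + (\<Sum>j<j. t j + 3))) (length p, X, w) = (length p + length c + 4, Y, v))"
    if "j \<le> m" for j
    using that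
  proof (induction j)
    case 0
    show ?case
    proof (intro exI conjI allI)
      show "I 0 (X(0 := 1)) w" by fact
      fix p q
      let ?P = "p @ map (reloc (length p)) (loop r c) @ q"
      have "step ?P (length p, X, w) = (Suc (length p), X(0 := 1), w)"
        by (simp add: loop_def step_at)
      moreover have "step ?P (Suc (length p), X(0 := 1), w) =
          (length p + length c + 4, X(0 := 1), w)"
        using step_at[of "p @ [Const 0 1]"] by (simp add: loop_def)
      ultimately show "(step ?P ^^ (2 + (\<Sum>j<0. t j + 3))) (length p, X, w) =
          (length p + length c + 4, X(0 := 1), w)"
        by (simp add: numeral_2_eq_2)
    qed
  next
    case (Suc j)
    then obtain Y v where Y: "I j Y v" and run: "\<And>p q. (step (p @ map (reloc (length p)) (loop r c) @ q) ^^
        (2 + (\<Sum>j<j. t j + 3))) (length p, X, w) = (length p + length c + 4, Y, v)"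
      by auto
    obtain Y' v' where Y': "runs B Y v (t j + 2) Y' v'" "I (Suc j) Y' v'"
      using body'[of j Y v] Y Suc.prems by auto
    show ?case
    proof (intro exI conjI allI)
      show "I (Suc j) Y' v'" by fact
      fix p q
      let ?P = "p @ map (reloc (length p)) (loop r c) @ q"
      let ?p = "p @ [Const 0 1, Jump_pos 0 (length p + (length c + 4))]"
      have P: "?P = ?p @ map (reloc (length ?p)) B @ Jump_pos r (length p + 2) # q"
        by (simp add: loop_def B_def o_def)
      have "0 < Y r"
        using inv[of j Y v] Y Suc.prems by simp
      then have jump: "(step ?P ^^ 1) (length p + length c + 4, Y, v) = (length ?p, Y, v)"
        using step_eq[of ?P "?p @ map (reloc (length ?p)) B" "Jump_pos r (length p + 2)" q
            "length p + length c + 4" Y v] P by (simp add: lenB)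
      have body: "(step ?P ^^ (t j + 2)) (length ?p, Y, v) = (length p + length c + 4, Y', v')"
      proof -
        have "length ?p + length B = length p + length c + 4"
          by (simp add: lenB)
        then show ?thesis
          using Y'(1)[unfolded runs_def, rule_format, of ?p "Jump_pos r (length p + 2) # q"]
          by (simp only: P[symmetric])
      qed
      have *: "(step ?P ^^ (t j + 2 + 1)) (length p + length c + 4, Y, v) =
          (length p + length c + 4, Y', v')"
        by (rule funpow_trans[OF jump body refl])
      show "(step ?P ^^ (2 + (\<Sum>j<Suc j. t j + 3))) (length p, X, w) =
          (length p + length c + 4, Y', v')"
        by (rule funpow_trans[OF run[of p q] *]) simp
    qed
  qed
  obtain Y v where Y: "I m Y v" and run: "\<And>p q. (step (p @ map (reloc (length p)) (loop r c) @ q) ^^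
        (2 + (\<Sum>j<m. t j + 3))) (length p, X, w) = (length p + length c + 4, Y, v)"
    using steps[of m] by auto
  have "runs (loop r c) X w (3 + (\<Sum>j<m. t j + 3)) Y v"
    unfolding runs_def
  proof (intro allI)
    fix p q
    let ?P = "p @ map (reloc (length p)) (loop r c) @ q"
    let ?p = "p @ [Const 0 1, Jump_pos 0 (length p + (length c + 4))]"
    have P: "?P = ?p @ map (reloc (length ?p)) B @ Jump_pos r (length p + 2) # q"
      by (simp add: loop_def B_def o_def)
    have "Y r = 0"
      using inv[of m Y v] Y by simp
    then have *: "(step ?P ^^ 1) (length p + length c + 4, Y, v) = (length p + length (loop r c), Y, v)"
      using step_eq[of ?P "?p @ map (reloc (length ?p)) B" "Jump_pos r (length p + 2)" q
          "length p + length c + 4" Y v] P by (simp add: lenB)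
    show "(step ?P ^^ (3 + (\<Sum>j<m. t j + 3))) (length p, X, w) =
        (length p + length (loop r c), Y, v)"
      by (rule funpow_trans[OF run[of p q] *]) simp
  qed
  then show ?thesis
    using Y by blast
qed

text \<open>A fragment that is the whole program halts when control leaves it, and halted
  configurations are fixed points. So any upper bound on the running time will do.\<close>

lemma runs_outputs_within:
  assumes "runs c (\<lambda>_. 0) w t X' w'" "t \<le> T"
  shows "outputs_within c w T (X' 0)"
proof -
  have *: "(step c ^^ t) (initial w) = (length c, X', w')"
    using assms(1)[unfolded runs_def, rule_format, of "[]" "[]"] by (simp add: initial_def)
  have "(step c ^^ n) (length c, X', w') = (length c, X', w')" for n
    by (induction n) (simp_all add: step_def halted_def)
  then have "(step c ^^ ((T - t) + t)) (initial w) = (length c, X', w')"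
    by (simp only: funpow_add o_apply *)
  then show ?thesis
    using assms(2) by (simp add: outputs_within_def halted_def)
qed

section \<open>Primitive recursive functions and their running time\<close>

text \<open>\<open>F\<close> is the exact running time of the program that \<open>primrec_compile\<close> extracts from the
  derivation.\<close>

inductive primrec_cost :: "nat \<Rightarrow> (nat list \<Rightarrow> nat) \<Rightarrow> (nat list \<Rightarrow> nat) \<Rightarrow> bool" where
  pc_var: "i < m \<Longrightarrow> primrec_cost m (\<lambda>xs. xs ! i) (\<lambda>_. 2)"
| pc_const: "primrec_cost m (\<lambda>_. a) (\<lambda>_. 1)"
| pc_add: "primrec_cost m f F \<Longrightarrow> primrec_cost m g G \<Longrightarrow>
    primrec_cost m (\<lambda>xs. f xs + g xs) (\<lambda>xs. F xs + (G xs + 1))"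
| pc_sub: "primrec_cost m f F \<Longrightarrow> primrec_cost m g G \<Longrightarrow>
    primrec_cost m (\<lambda>xs. f xs - g xs) (\<lambda>xs. F xs + (G xs + 1))"
| pc_comp: "length hs = length fs \<Longrightarrow> (\<And>i. i < length fs \<Longrightarrow> primrec_cost m (fs ! i) (hs ! i)) \<Longrightarrow>
    primrec_cost (length fs) g G \<Longrightarrow>
    primrec_cost m (\<lambda>xs. g (map (\<lambda>f. f xs) fs))
      (\<lambda>xs. (\<Sum>i<length fs. (hs ! i) xs) + (G (map (\<lambda>f. f xs) fs) + 2))"
| pc_rec: "primrec_cost m n N \<Longrightarrow> primrec_cost m a A \<Longrightarrow> primrec_cost (m + 2) b B \<Longrightarrow>
    primrec_cost m (\<lambda>xs. rec_nat (a xs) (\<lambda>j y. b (xs @ [j, y])) (n xs))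
      (\<lambda>xs. N xs + (A xs + (1 + (3 + (\<Sum>j<n xs.
         B (xs @ [j, rec_nat (a xs) (\<lambda>j y. b (xs @ [j, y])) j]) + 4 + 3) + 2))))"
| pc_ext: "primrec_cost m f F \<Longrightarrow> (\<And>xs. length xs = m \<Longrightarrow> f' xs = f xs) \<Longrightarrow>
    (\<And>xs. length xs = m \<Longrightarrow> F' xs = F xs) \<Longrightarrow> primrec_cost m f' F'"

text \<open>The arguments are in the registers \<open>L\<close>, the result goes to register \<open>s\<close>. Registers above \<open>s\<close>
  are work space, and register \<open>0\<close> is scratch space that every fragment may overwrite.\<close>

definition computes :: "nat list \<Rightarrow> nat \<Rightarrow> instr list \<Rightarrow> (nat list \<Rightarrow> nat) \<Rightarrow> (nat list \<Rightarrow> nat) \<Rightarrow> bool" where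
  "computes L s c f F \<longleftrightarrow> (\<forall>X w. \<exists>X'. runs c X w (F (map X L)) X' w \<and>
     X' s = f (map X L) \<and> (\<forall>r. 0 < r \<and> r < s \<longrightarrow> X' r = X r))"

text \<open>Evaluates a list of functions into consecutive registers. Each stored result moves the
  start of the work space up by one and is thereby protected from later fragments; hence the
  hypothesis for arbitrary \<open>s\<close>.\<close>

lemma computes_list:
  assumes "\<And>f h L s. (f, h) \<in> set fhs \<Longrightarrow> length L = m \<Longrightarrow> set L \<subseteq> {0<..<s} \<Longrightarrow> 0 < s \<Longrightarrow>
      \<exists>c. computes L s c f h"
    and "length L = m" "set L \<subseteq> {0<..<s}" "0 < s"
  shows "\<exists>c. \<forall>X w. \<exists>X'. runs c X w (\<Sum>(f, h)\<leftarrow>fhs. h (map X L)) X' w \<and>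
     map X' [s..<s + length fhs] = map (\<lambda>(f, h). f (map X L)) fhs \<and>
     (\<forall>r. 0 < r \<and> r < s \<longrightarrow> X' r = X r)"
  using assms(1,3,4)
proof (induction fhs arbitrary: s)
  case Nil
  have "runs [] X w 0 X w" for X w
    by (simp add: runs_def)
  then show ?case
    by auto
next
  case (Cons fh fhs)
  obtain f h where fh: "fh = (f, h)"
    by fastforce
  have "\<exists>c. computes L s c f h"
    by (rule Cons.prems(1)) (simp_all add: fh assms(2) Cons.prems(2,3))
  then obtain c where c: "computes L s c f h" ..
  have L: "set L \<subseteq> {0<..<Suc s}"
    using Cons.prems(2) by auto
  have "\<exists>c. computes L s c f h"
    if "(f, h) \<in> set fhs" "length L = m" "set L \<subseteq> {0<..<s}" "0 < s" for f h L s
    using Cons.prems(1) that by simp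
  from Cons.IH[OF this L] obtain d where d: "\<And>X w. \<exists>X'. runs d X w (\<Sum>(f, h)\<leftarrow>fhs. h (map X L)) X' w \<and>
      map X' [Suc s..<Suc s + length fhs] = map (\<lambda>(f, h). f (map X L)) fhs \<and>
      (\<forall>r. 0 < r \<and> r < Suc s \<longrightarrow> X' r = X r)"
    by auto
  show ?case
  proof (intro exI[of _ "c ;; d"] allI)
    fix X w
    obtain Y where Y: "runs c X w (h (map X L)) Y w" "Y s = f (map X L)"
      "\<And>r. 0 < r \<Longrightarrow> r < s \<Longrightarrow> Y r = X r"
      using c[unfolded computes_def, rule_format, of X w] by (auto)
    have [simp]: "map Y L = map X L"
      using Y(3) Cons.prems(2) by auto
    obtain Z where Z: "runs d Y w (\<Sum>(f, h)\<leftarrow>fhs. h (map X L)) Z w"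
      "map Z [Suc s..<Suc s + length fhs] = map (\<lambda>(f, h). f (map X L)) fhs"
      "\<And>r. 0 < r \<Longrightarrow> r < Suc s \<Longrightarrow> Z r = Y r"
      using d[of Y w] by auto
    have "[s..<s + length (fh # fhs)] = s # [Suc s..<Suc s + length fhs]"
      by (simp add: upt_rec)
    then show "\<exists>X'. runs (c ;; d) X w (\<Sum>(f, h)\<leftarrow>fh # fhs. h (map X L)) X' w \<and>
      map X' [s..<s + length (fh # fhs)] = map (\<lambda>(f, h). f (map X L)) (fh # fhs) \<and>
      (\<forall>r. 0 < r \<and> r < s \<longrightarrow> X' r = X r)"
      using runs_seq[OF Y(1) Z(1)] Y(2,3) Z(2,3) \<open>0 < s\<close> by (intro exI[of _ Z]) (simp add: fh)
  qed
qed

lemma computes_binary: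
  assumes c: "computes L s c f F" and d: "computes L (Suc s) d g G" and "set L \<subseteq> {0<..<s}" "0 < s"
    and i: "\<And>X w. runs [i] X w 1 (X(s := op (X s) (X (Suc s)))) w"
  shows "computes L s (c ;; d ;; [i]) (\<lambda>xs. op (f xs) (g xs)) (\<lambda>xs. F xs + (G xs + 1))"
  unfolding computes_def
proof (intro allI)
  fix X w
  obtain Y where Y: "runs c X w (F (map X L)) Y w" "Y s = f (map X L)"
    "\<And>r. 0 < r \<Longrightarrow> r < s \<Longrightarrow> Y r = X r"
    using c[unfolded computes_def, rule_format, of X w] by (auto)
  have eq: "map Y L = map X L"
    using Y(3) assms(3) by auto
  obtain Z where Z: "runs d Y w (G (map X L)) Z w" "Z (Suc s) = g (map X L)"
    "\<And>r. 0 < r \<Longrightarrow> r < Suc s \<Longrightarrow> Z r = Y r"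
    using d[unfolded computes_def, rule_format, of Y w] eq by auto
  show "\<exists>X'. runs (c ;; d ;; [i]) X w (F (map X L) + (G (map X L) + 1)) X' w \<and>
      X' s = op (f (map X L)) (g (map X L)) \<and> (\<forall>r. 0 < r \<and> r < s \<longrightarrow> X' r = X r)"
    using runs_seq[OF Y(1) runs_seq[OF Z(1) i]] Y(2,3) Z(2,3) \<open>0 < s\<close>
    by (intro exI[of _ "Z(s := op (Z s) (Z (Suc s)))"]) simp
qed

text \<open>Register \<open>s\<close> holds the rounds left, \<open>s + 1\<close> the recursion
  value, \<open>s + 2\<close> the index; the step function works from \<open>s + 3\<close> on. The
  loop counter descends while \<open>rec_nat\<close> passes ascending indices, hence the separate
  index. In each round 4 pays for copying the value back and incrementing the index, 3 for the loop
  itself.\<close>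

lemma computes_rec:
  assumes cn: "computes L s cn n N" and ca: "computes L (s + 1) ca a A"
    and cb: "computes (L @ [s + 2, s + 1]) (s + 3) cb b B"
    and L: "set L \<subseteq> {0<..<s}" "0 < s"
  defines "R \<equiv> \<lambda>xs. rec_nat (a xs) (\<lambda>j y. b (xs @ [j, y]))"
  shows "computes L s (cn ;; ca ;; [Const (s + 2) 0] ;;
       loop s (cb ;; move (s + 1) (s + 3) ;; [Const 0 1] ;; [Add (s + 2) (s + 2) 0]) ;; move s (s + 1))
     (\<lambda>xs. R xs (n xs))
     (\<lambda>xs. N xs + (A xs + (1 + (3 + (\<Sum>j<n xs. B (xs @ [j, R xs j]) + 4 + 3) + 2))))"
  unfolding computes_def
proof (intro allI)
  fix X :: "nat \<Rightarrow> nat" and w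
  define xs where "xs = map X L"
  obtain Y where Y: "runs cn X w (N xs) Y w" "Y s = n xs" "\<And>r. 0 < r \<Longrightarrow> r < s \<Longrightarrow> Y r = X r"
    using cn[unfolded computes_def, rule_format, of X w] by (auto simp: xs_def)
  have eq: "map Y L = xs"
    using Y(3) L by (auto simp: xs_def)
  obtain Z where Z: "runs ca Y w (A xs) Z w" "Z (s + 1) = a xs"
    "\<And>r. 0 < r \<Longrightarrow> r < s + 1 \<Longrightarrow> Z r = Y r"
    using ca[unfolded computes_def, rule_format, of Y w] eq by auto
  define I where "I j V v \<longleftrightarrow> v = w \<and> V s = n xs - j \<and> V (s + 1) = R xs j \<and> V (s + 2) = j \<and>
    (\<forall>r. 0 < r \<and> r < s \<longrightarrow> V r = X r)" for j V v
  let ?body = "cb ;; move (s + 1) (s + 3) ;; [Const 0 1] ;; [Add (s + 2) (s + 2) 0]"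
  have "\<exists>X' w'. runs (loop s ?body) (Z(s + 2 := 0)) w
      (3 + (\<Sum>j<n xs. B (xs @ [j, R xs j]) + 4 + 3)) X' w' \<and> I (n xs) X' w'"
  proof (rule runs_loop)
    show "0 < s" by fact
    show "I 0 ((Z(s + 2 := 0))(0 := 1)) w"
      using Z Y L by (simp add: I_def R_def)
    fix j V v
    show "I j V v \<Longrightarrow> V s = n xs - j"
      by (simp add: I_def)
    assume j: "j < n xs" and I: "I j V v"
    let ?V = "V(0 := 1, s := n xs - Suc j)"
    have "v = w"
      using I by (simp add: I_def)
    have eq: "map ?V (L @ [s + 2, s + 1]) = xs @ [j, R xs j]"
      using I L by (auto simp: I_def xs_def)
    obtain W where W: "runs cb ?V w (B (xs @ [j, R xs j])) W w" "W (s + 3) = b (xs @ [j, R xs j])"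
      "\<And>r. 0 < r \<Longrightarrow> r < s + 3 \<Longrightarrow> W r = ?V r"
      using cb[unfolded computes_def, rule_format, of ?V w] eq by auto
    have "0 < s + 3" by simp
    note run = runs_seq[OF W(1) runs_seq[OF runs_move[OF this, of "s + 1"]
          runs_seq[OF runs_Const[of 0 1] runs_Add[of "s + 2" "s + 2" 0]]]]
    show "\<exists>X' w'. runs ?body ?V v (B (xs @ [j, R xs j]) + 4) X' w' \<and> I (Suc j) X' w'"
      using run W(2,3) I L \<open>v = w\<close> \<open>0 < s\<close>
      by (intro exI[of _ "W(0 := 0, s + 1 := W (s + 3), 0 := 1, s + 2 := W (s + 2) + 1)"] exI[of _ w] conjI)
        (simp_all add: I_def R_def numeral_eq_Suc)
  qed
  then obtain V where V: "runs (loop s ?body) (Z(s + 2 := 0)) w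
      (3 + (\<Sum>j<n xs. B (xs @ [j, R xs j]) + 4 + 3)) V w" "I (n xs) V w"
    by (auto simp: I_def)
  have "0 < s + 1" by simp
  note run = runs_seq[OF Y(1) runs_seq[OF Z(1) runs_seq[OF runs_Const runs_seq[OF V(1) runs_move[OF this, of s]]]]]
  show "\<exists>X'. runs (cn ;; ca ;; [Const (s + 2) 0] ;; loop s ?body ;; move s (s + 1)) X w
      (N (map X L) + (A (map X L) + (1 + (3 + (\<Sum>j<n (map X L).
         B (map X L @ [j, R (map X L) j]) + 4 + 3) + 2)))) X' w \<and>
      X' s = R (map X L) (n (map X L)) \<and> (\<forall>r. 0 < r \<and> r < s \<longrightarrow> X' r = X r)"
    using run V(2) unfolding xs_def[symmetric]
    by (intro exI[of _ "V(0 := 0, s := V (s + 1))"]) (simp add: I_def)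
qed

text \<open>Induction along the derivation, for all \<open>L\<close> and \<open>s\<close>: a subterm
  is compiled with its work space further up, and inside a composition or recursion also with other
  argument registers.\<close>

lemma primrec_compile:
  assumes "primrec_cost m f F" "length L = m" "set L \<subseteq> {0<..<s}" "0 < s"
  shows "\<exists>c. computes L s c f F"
  using assms
proof (induction arbitrary: L s rule: primrec_cost.induct)
  case (pc_var i m)
  then have "0 < L ! i"
    by (meson greaterThanLessThan_iff nth_mem subsetD)
  then show ?case
    using runs_move[of "L ! i" s] pc_var
    by (intro exI[of _ "move s (L ! i)"], unfold computes_def) fastforce
next
  case (pc_const m a)
  show ?case
    using runs_Const[of s a] by (intro exI[of _ "[Const s a]"], unfold computes_def) fastforce
next
  case (pc_add m f F g G)
  have L: "set L \<subseteq> {0<..<Suc s}"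
    using pc_add.prems by auto
  obtain c d where "computes L s c f F" "computes L (Suc s) d g G"
    using pc_add.IH(1)[OF pc_add.prems] pc_add.IH(2)[OF pc_add.prems(1) L] by auto
  then show ?case
    using computes_binary[where op = "(+)", OF _ _ pc_add.prems(2,3) runs_Add] by blast
next
  case (pc_sub m f F g G)
  have L: "set L \<subseteq> {0<..<Suc s}"
    using pc_sub.prems by auto
  obtain c d where "computes L s c f F" "computes L (Suc s) d g G"
    using pc_sub.IH(1)[OF pc_sub.prems] pc_sub.IH(2)[OF pc_sub.prems(1) L] by auto
  then show ?case
    using computes_binary[where op = "(-)", OF _ _ pc_sub.prems(2,3) runs_Sub] by blast
next
  case (pc_comp hs fs m g G)
  \<comment> \<open>The inner results fill the registers \<open>?L\<close>, which then serve as
    argument registers of the outer function.\<close>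
  let ?L = "[s..<s + length fs]"
  have zip: "map (\<lambda>(f, h). f x) (zip fs hs) = map (\<lambda>f. f x) fs" for x
    using pc_comp.hyps(1) by (auto intro: nth_equalityI)
  have sum: "(\<Sum>(f, h)\<leftarrow>zip fs hs. h x) = (\<Sum>i<length fs. (hs ! i) x)" for x
    using pc_comp.hyps(1) by (simp add: sum_list_sum_nth atLeast0LessThan)
  have "\<exists>c. computes L s c f h"
    if fh: "(f, h) \<in> set (zip fs hs)" and L: "length L = m" "set L \<subseteq> {0<..<s}" "0 < s" for f h L s
    using fh L pc_comp.IH(1) by (auto simp: set_zip)
  from computes_list[of "zip fs hs", OF this pc_comp.prems]
  obtain c where c: "\<And>X w. \<exists>X'. runs c X w (\<Sum>i<length fs. (hs ! i) (map X L)) X' w \<and>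
      map X' ?L = map (\<lambda>f. f (map X L)) fs \<and> (\<forall>r. 0 < r \<and> r < s \<longrightarrow> X' r = X r)"
    using pc_comp.hyps(1) by (auto simp: zip sum)
  have "set ?L \<subseteq> {0<..<s + length fs}"
    using pc_comp.prems(3) by auto
  then obtain d where d: "computes ?L (s + length fs) d g G"
    using pc_comp.IH(2)[of ?L "s + length fs"] pc_comp.prems(3) by auto
  show ?case
  proof (intro exI[of _ "c ;; d ;; move s (s + length fs)"], unfold computes_def, intro allI)
    fix X w
    obtain Y where Y: "runs c X w (\<Sum>i<length fs. (hs ! i) (map X L)) Y w"
      "map Y ?L = map (\<lambda>f. f (map X L)) fs" "\<And>r. 0 < r \<Longrightarrow> r < s \<Longrightarrow> Y r = X r"
      using c[of X w] by auto
    obtain Z where Z: "runs d Y w (G (map (\<lambda>f. f (map X L)) fs)) Z w"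
      "Z (s + length fs) = g (map (\<lambda>f. f (map X L)) fs)"
      "\<And>r. 0 < r \<Longrightarrow> r < s + length fs \<Longrightarrow> Z r = Y r"
      using d[unfolded computes_def, rule_format, of Y w] Y(2) by auto
    have "0 < s + length fs"
      using pc_comp.prems(3) by simp
    note run = runs_seq[OF Y(1) runs_seq[OF Z(1) runs_move[OF this, of s]]]
    show "\<exists>X'. runs (c ;; d ;; move s (s + length fs)) X w
        ((\<Sum>i<length fs. (hs ! i) (map X L)) + (G (map (\<lambda>f. f (map X L)) fs) + 2)) X' w \<and>
        X' s = g (map (\<lambda>f. f (map X L)) fs) \<and> (\<forall>r. 0 < r \<and> r < s \<longrightarrow> X' r = X r)"
      using run Y(3) Z(2,3) by (intro exI[of _ "Z(0 := 0, s := Z (s + length fs))"]) simp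
  qed
next
  case (pc_rec m n N a A b B)
  have L: "set L \<subseteq> {0<..<s + 1}" "set (L @ [s + 2, s + 1]) \<subseteq> {0<..<s + 3}"
    "length (L @ [s + 2, s + 1]) = m + 2"
    using pc_rec.prems by auto
  obtain cn ca cb where "computes L s cn n N" "computes L (s + 1) ca a A"
    "computes (L @ [s + 2, s + 1]) (s + 3) cb b B"
    using pc_rec.IH(1)[OF pc_rec.prems] pc_rec.IH(2)[OF pc_rec.prems(1) L(1)]
      pc_rec.IH(3)[OF L(3) L(2)] by auto
  then show ?case
    using computes_rec[OF _ _ _ pc_rec.prems(2,3)] by blast
next
  case (pc_ext m f F f' F')
  then obtain c where "computes L s c f F"
    by blast
  moreover have "f' (map X L) = f (map X L)" "F' (map X L) = F (map X L)" for X
    using pc_ext by simp_all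
  ultimately show ?case
    unfolding computes_def by auto
qed

section \<open>Closure properties of primitive recursive functions\<close>

definition primrec_fun :: "nat \<Rightarrow> (nat list \<Rightarrow> nat) \<Rightarrow> bool" where
  "primrec_fun m f \<longleftrightarrow> (\<exists>F. primrec_cost m f F)"

lemma primrec_fun_cong:
  assumes "primrec_fun m g" "\<And>xs. length xs = m \<Longrightarrow> f xs = g xs"
  shows "primrec_fun m f"
proof -
  obtain F where "primrec_cost m g F"
    using assms(1) unfolding primrec_fun_def by blast
  from pc_ext[OF this assms(2), of F] show ?thesis
    unfolding primrec_fun_def by blast
qed

lemma primrec_nth: "i < m \<Longrightarrow> primrec_fun m (\<lambda>xs. xs ! i)"
  unfolding primrec_fun_def using pc_var by blast

lemma primrec_const: "primrec_fun m (\<lambda>_. a)"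
  unfolding primrec_fun_def using pc_const by blast

lemma primrec_add: "primrec_fun m f \<Longrightarrow> primrec_fun m g \<Longrightarrow> primrec_fun m (\<lambda>xs. f xs + g xs)"
  unfolding primrec_fun_def using pc_add by blast

lemma primrec_diff: "primrec_fun m f \<Longrightarrow> primrec_fun m g \<Longrightarrow> primrec_fun m (\<lambda>xs. f xs - g xs)"
  unfolding primrec_fun_def using pc_sub by blast

lemma primrec_comp:
  assumes "\<And>f. f \<in> set fs \<Longrightarrow> primrec_fun m f" "primrec_fun (length fs) g"
  shows "primrec_fun m (\<lambda>xs. g (map (\<lambda>f. f xs) fs))"
proof -
  obtain h where h: "\<And>f. f \<in> set fs \<Longrightarrow> primrec_cost m f (h f)"
    using assms(1) unfolding primrec_fun_def by metis
  obtain G where "primrec_cost (length fs) g G"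
    using assms(2) unfolding primrec_fun_def by blast
  from pc_comp[OF _ _ this, of "map h fs" m] show ?thesis
    unfolding primrec_fun_def using h by auto
qed

lemma primrec_comp1:
  assumes "primrec_fun 1 (\<lambda>xs. g (xs ! 0))" "primrec_fun m f0"
  shows "primrec_fun m (\<lambda>xs. g (f0 xs))"
  using primrec_comp[of "[f0]" m "\<lambda>xs. g (xs ! 0)"] assms by simp

lemma primrec_comp2:
  assumes "primrec_fun 2 (\<lambda>xs. g (xs ! 0) (xs ! 1))" "primrec_fun m f0" "primrec_fun m f1"
  shows "primrec_fun m (\<lambda>xs. g (f0 xs) (f1 xs))"
  using primrec_comp[of "[f0, f1]" m "\<lambda>xs. g (xs ! 0) (xs ! 1)"] assms
  by (auto simp: numeral_2_eq_2)

lemma primrec_comp_take: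
  assumes "primrec_fun m f" "m \<le> m'"
  shows "primrec_fun m' (\<lambda>xs. f (take m xs))"
proof -
  have "primrec_fun m' (\<lambda>xs. f (map (\<lambda>g. g xs) (map (\<lambda>i xs. xs ! i) [0..<m])))"
    by (rule primrec_comp) (use assms in \<open>auto intro: primrec_nth\<close>)
  then show ?thesis
  proof (rule primrec_fun_cong)
    fix xs :: "nat list" assume "length xs = m'"
    then have "take m xs = map (\<lambda>g. g xs) (map (\<lambda>i xs. xs ! i) [0..<m])"
      using assms(2) by (auto intro: nth_equalityI)
    then show "f (take m xs) = f (map (\<lambda>g. g xs) (map (\<lambda>i xs. xs ! i) [0..<m]))"
      by simp
  qed
qed

text \<open>Shaped as an introduction rule: index and previous value are appended to the parameters
  at positions \<open>m\<close> and \<open>m + 1\<close>, and \<open>take m ys\<close> recovers the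
  parameters. The rules for sums and bounded quantifiers treat their bound variable in the same
  way.\<close>

lemma primrec_rec_nat:
  assumes "primrec_fun m n" "primrec_fun m a"
    "primrec_fun (m + 2) (\<lambda>ys. b (ys ! m) (ys ! (m + 1)) (take m ys))"
  shows "primrec_fun m (\<lambda>xs. rec_nat (a xs) (\<lambda>j y. b j y xs) (n xs))"
proof -
  let ?b = "\<lambda>ys. b (ys ! m) (ys ! (m + 1)) (take m ys)"
  obtain N A B where "primrec_cost m n N" "primrec_cost m a A" "primrec_cost (m + 2) ?b B"
    using assms unfolding primrec_fun_def by blast
  then have "primrec_fun m (\<lambda>xs. rec_nat (a xs) (\<lambda>j y. ?b (xs @ [j, y])) (n xs))"
    unfolding primrec_fun_def using pc_rec by blast
  then show ?thesis
    by (rule primrec_fun_cong) (simp add: nth_append)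
qed

lemma primrec_sum:
  assumes "primrec_fun m n" "primrec_fun (m + 1) (\<lambda>ys. f (ys ! m) (take m ys))"
  shows "primrec_fun m (\<lambda>xs. \<Sum>j<n xs. f j xs)"
proof -
  have "primrec_fun (m + 2) (\<lambda>ys. f (ys ! m) (take m ys))"
    using primrec_comp_take[OF assms(2), of "m + 2"]
    by (rule primrec_fun_cong) (simp_all add: min_def)
  then have "primrec_fun m (\<lambda>xs. rec_nat 0 (\<lambda>j y. y + f j xs) (n xs))"
    by (intro primrec_rec_nat primrec_const primrec_add primrec_nth assms(1)) simp_all
  moreover have "(\<Sum>j<n. f j xs) = rec_nat 0 (\<lambda>j y. y + f j xs) n" for n xs
    by (induction n) auto
  ultimately show ?thesis
    by simp
qed

text \<open>Substitution for the last two arguments, which are index and previous value when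
  \<open>f\<close> is the step function of a recursion or its cost.\<close>

lemma primrec_comp_append2:
  assumes "primrec_fun (m + 2) f" "primrec_fun m' a" "primrec_fun m' b" "m \<le> m'"
  shows "primrec_fun m' (\<lambda>xs. f (take m xs @ [a xs, b xs]))"
proof -
  let ?fs = "map (\<lambda>i xs. xs ! i) [0..<m] @ [a, b]"
  have "primrec_fun m' (\<lambda>xs. f (map (\<lambda>g. g xs) ?fs))"
    by (rule primrec_comp) (use assms in \<open>auto intro: primrec_nth\<close>)
  then show ?thesis
  proof (rule primrec_fun_cong)
    fix xs :: "nat list" assume "length xs = m'"
    then have "take m xs = map (\<lambda>i. xs ! i) [0..<m]"
      using assms(4) by (auto intro: nth_equalityI)
    then show "f (take m xs @ [a xs, b xs]) = f (map (\<lambda>g. g xs) ?fs)"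
      by (simp add: o_def)
  qed
qed

text \<open>The recursion of the cost equations only refers to values and costs of subderivations,
  so the running time is again primitive recursive.\<close>

lemma primrec_primrec_cost:
  assumes "primrec_cost m f F"
  shows "primrec_fun m F"
  using assms
proof (induction rule: primrec_cost.induct)
  case (pc_comp hs fs m g G)
  have 1: "primrec_fun m (\<lambda>xs. G (map (\<lambda>f. f xs) fs))"
    by (rule primrec_comp) (use pc_comp in \<open>auto simp: in_set_conv_nth primrec_fun_def\<close>)
  have "primrec_fun m (\<lambda>xs. \<Sum>i<n. (hs ! i) xs)" if "n \<le> length fs" for n
    using that by (induction n) (auto intro!: primrec_const primrec_add pc_comp.IH)
  then show ?case
    using 1 by (intro primrec_add primrec_const) simp_all
next
  case (pc_rec m n N a A b B)
  let ?R = "\<lambda>xs j. rec_nat (a xs) (\<lambda>j y. b (xs @ [j, y])) j"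
  have f: "primrec_fun m n" "primrec_fun m a" "primrec_fun (m + 2) b"
    using pc_rec.hyps by (auto simp: primrec_fun_def)
  \<comment> \<open>The cost of round \<open>j\<close> depends on the value reached after
    \<open>j\<close> rounds, so that value is needed as a function of the extra argument
    \<open>j\<close>.\<close>
  have "primrec_fun (m + 1) (\<lambda>ys. ?R (take m ys) (ys ! m))"
  proof (rule primrec_rec_nat[where b = "\<lambda>j y ys. b (take m ys @ [j, y])"])
    show "primrec_fun (m + 1) (\<lambda>ys. ys ! m)"
      by (rule primrec_nth) simp
    show "primrec_fun (m + 1) (\<lambda>ys. a (take m ys))"
      by (rule primrec_comp_take[OF f(2)]) simp
    have "primrec_fun (m + 1 + 2) (\<lambda>ys. b (take m ys @ [ys ! (m + 1), ys ! (m + 1 + 1)]))"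
      by (rule primrec_comp_append2[OF f(3)]) (auto intro: primrec_nth)
    then show "primrec_fun (m + 1 + 2) (\<lambda>ys. b (take m (take (m + 1) ys) @ [ys ! (m + 1), ys ! (m + 1 + 1)]))"
      by (simp add: min_def)
  qed
  then have "primrec_fun (m + 1) (\<lambda>ys. B (take m ys @ [ys ! m, ?R (take m ys) (ys ! m)]))"
    by (intro primrec_comp_append2[OF pc_rec.IH(3)] primrec_nth) simp_all
  then show ?case
    using pc_rec.IH(1,2) f by (intro primrec_add primrec_const primrec_sum) simp_all
next
  case (pc_ext m f F f' F')
  then show ?case
    by (blast intro: primrec_fun_cong)
qed (intro primrec_const primrec_add; assumption)+

text \<open>Register 0 is scratch space for fragments but the output register of the machine, hence
  the final copy.\<close>

lemma primrec_computable:
  assumes "primrec_fun 1 (\<lambda>xs. f (xs ! 0))"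
  shows "computable f"
proof -
  obtain F where "primrec_cost 1 (\<lambda>xs. f (xs ! 0)) F"
    using assms unfolding primrec_fun_def by blast
  from primrec_compile[OF this, of "[1]" 2]
  obtain c where c: "computes [1] 2 c (\<lambda>xs. f (xs ! 0)) F"
    by auto
  have "\<exists>t. outputs_within ([Read 1] ;; c ;; move 0 2) [x] t (f x)" for x
  proof -
    let ?X = "(\<lambda>_. 0 :: nat)(1 := x)"
    obtain Y where Y: "runs c ?X [] (F [x]) Y []" "Y 2 = f x"
      using c[unfolded computes_def, rule_format, of ?X "[]"] by auto
    have "0 < (2 :: nat)" by simp
    from runs_seq[OF runs_Read[of 1 "\<lambda>_. 0"] runs_seq[OF Y(1) runs_move[OF this, of 0]]]
    show ?thesis
      using runs_outputs_within[OF _ order_refl] Y(2) by fastforce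
  qed
  then show ?thesis
    unfolding computable_def by blast
qed

lemma primrec_mult: "primrec_fun m f \<Longrightarrow> primrec_fun m g \<Longrightarrow> primrec_fun m (\<lambda>xs. f xs * g xs)"
proof -
  have "primrec_fun 2 (\<lambda>xs. \<Sum>j<xs ! 0. xs ! 1)"
    by (rule primrec_sum) (simp_all add: primrec_nth)
  then have "primrec_fun 2 (\<lambda>xs. xs ! 0 * xs ! 1)"
    by simp
  then show "primrec_fun m f \<Longrightarrow> primrec_fun m g \<Longrightarrow> primrec_fun m (\<lambda>xs. f xs * g xs)"
    by (rule primrec_comp2)
qed

lemma primrec_power: "primrec_fun m f \<Longrightarrow> primrec_fun m g \<Longrightarrow> primrec_fun m (\<lambda>xs. f xs ^ g xs)"
proof -
  have "primrec_fun 2 (\<lambda>xs. rec_nat 1 (\<lambda>j y. xs ! 0 * y) (xs ! 1))"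
    by (rule primrec_rec_nat) (simp_all add: primrec_nth primrec_const primrec_mult)
  moreover have "rec_nat 1 (\<lambda>j y. x * y) n = x ^ n" for x n :: nat
    by (induction n) auto
  ultimately have "primrec_fun 2 (\<lambda>xs. xs ! 0 ^ xs ! 1)"
    by simp
  then show "primrec_fun m f \<Longrightarrow> primrec_fun m g \<Longrightarrow> primrec_fun m (\<lambda>xs. f xs ^ g xs)"
    by (rule primrec_comp2)
qed

section \<open>Primitive recursive predicates and bounded quantifiers\<close>

definition primrec_pred :: "nat \<Rightarrow> (nat list \<Rightarrow> bool) \<Rightarrow> bool" where
  "primrec_pred m P \<longleftrightarrow> primrec_fun m (\<lambda>xs. of_bool (P xs))"

lemma primrec_of_bool: "primrec_pred m P \<Longrightarrow> primrec_fun m (\<lambda>xs. of_bool (P xs))"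
  by (simp add: primrec_pred_def)

lemma primrec_pred_cong:
  assumes "primrec_pred m Q" "\<And>xs. length xs = m \<Longrightarrow> P xs \<longleftrightarrow> Q xs"
  shows "primrec_pred m P"
  using assms(1) unfolding primrec_pred_def
  by (rule primrec_fun_cong) (simp add: assms(2))

lemma primrec_le: "primrec_fun m f \<Longrightarrow> primrec_fun m g \<Longrightarrow> primrec_pred m (\<lambda>xs. f xs \<le> g xs)"
  unfolding primrec_pred_def
  by (rule primrec_fun_cong[where g = "\<lambda>xs. 1 - (f xs - g xs)"])
    (auto intro!: primrec_diff primrec_const)

lemma primrec_not: "primrec_pred m P \<Longrightarrow> primrec_pred m (\<lambda>xs. \<not> P xs)"
  unfolding primrec_pred_def
  by (rule primrec_fun_cong[where g = "\<lambda>xs. 1 - of_bool (P xs)"])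
    (auto intro!: primrec_diff primrec_const)

lemma primrec_conj: "primrec_pred m P \<Longrightarrow> primrec_pred m Q \<Longrightarrow> primrec_pred m (\<lambda>xs. P xs \<and> Q xs)"
  unfolding primrec_pred_def by (simp add: of_bool_conj primrec_mult)

lemma primrec_disj:
  assumes "primrec_pred m P" "primrec_pred m Q"
  shows "primrec_pred m (\<lambda>xs. P xs \<or> Q xs)"
proof -
  have "primrec_pred m (\<lambda>xs. \<not> (\<not> P xs \<and> \<not> Q xs))"
    by (intro primrec_not primrec_conj assms)
  then show ?thesis
    by simp
qed

lemma primrec_imp:
  assumes "primrec_pred m P" "primrec_pred m Q"
  shows "primrec_pred m (\<lambda>xs. P xs \<longrightarrow> Q xs)"
proof -
  have "primrec_pred m (\<lambda>xs. \<not> P xs \<or> Q xs)"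
    by (intro primrec_not primrec_disj assms)
  then show ?thesis
    by (rule primrec_pred_cong) simp
qed

lemma primrec_eq:
  assumes "primrec_fun m f" "primrec_fun m g"
  shows "primrec_pred m (\<lambda>xs. f xs = g xs)"
proof -
  have "primrec_pred m (\<lambda>xs. f xs \<le> g xs \<and> g xs \<le> f xs)"
    by (intro primrec_conj primrec_le assms)
  then show ?thesis
    by (rule primrec_pred_cong) auto
qed

lemma primrec_bex:
  assumes "primrec_fun m n" "primrec_pred (m + 1) (\<lambda>ys. P (ys ! m) (take m ys))"
  shows "primrec_pred m (\<lambda>xs. \<exists>j<n xs. P j xs)"
proof -
  have "primrec_pred m (\<lambda>xs. 1 \<le> (\<Sum>j<n xs. of_bool (P j xs) :: nat))"
    using assms by (intro primrec_le primrec_const primrec_sum primrec_of_bool)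
  then show ?thesis
    by (rule primrec_pred_cong) (auto simp: Suc_le_eq card_gt_0_iff)
qed

lemma primrec_ball:
  assumes "primrec_fun m n" "primrec_pred (m + 1) (\<lambda>ys. P (ys ! m) (take m ys))"
  shows "primrec_pred m (\<lambda>xs. \<forall>j<n xs. P j xs)"
proof -
  have "primrec_pred m (\<lambda>xs. \<not> (\<exists>j<n xs. \<not> P j xs))"
    by (intro primrec_not primrec_bex assms)
  then show ?thesis
    by simp
qed

text \<open>Bit \<open>i\<close> of \<open>x\<close> is the parity of \<open>x div 2 ^ i\<close>.
  Division is replaced by a bounded search for \<open>q\<close> and \<open>r\<close> with
  \<open>x = (2 * q + 1) * 2 ^ i + r\<close>, where \<open>2 * q + 1\<close> is the odd
  quotient.\<close>

lemma primrec_bit: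
  assumes "primrec_fun m f" "primrec_fun m g"
  shows "primrec_pred m (\<lambda>xs. f xs \<in> set_decode (g xs))"
proof -
  have "i \<in> set_decode x \<longleftrightarrow> (\<exists>q<x + 1. \<exists>r<2 ^ i. x = (2 * q + 1) * 2 ^ i + r)" for i x :: nat
  proof
    assume "i \<in> set_decode x"
    then have "odd (x div 2 ^ i)"
      by (simp add: set_decode_def)
    then obtain q where q: "x div 2 ^ i = 2 * q + 1"
      by (elim oddE)
    have x: "x = (2 * q + 1) * 2 ^ i + x mod 2 ^ i"
      unfolding q[symmetric] by (rule div_mult_mod_eq[symmetric])
    moreover have "q < x + 1"
      using q by (metis add.commute add_lessD1 div_le_dividend le_imp_less_Suc mult_2 plus_1_eq_Suc)
    moreover have "x mod 2 ^ i < 2 ^ i"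
      by simp
    ultimately show "\<exists>q<x + 1. \<exists>r<2 ^ i. x = (2 * q + 1) * 2 ^ i + r"
      by blast
  next
    assume "\<exists>q<x + 1. \<exists>r<2 ^ i. x = (2 * q + 1) * 2 ^ i + r"
    then obtain q r where "r < 2 ^ i" "x = (2 * q + 1) * 2 ^ i + r"
      by blast
    then have "x div 2 ^ i = 2 * q + 1"
      by (intro div_nat_eqI) (simp_all add: algebra_simps)
    then show "i \<in> set_decode x"
      by (simp add: set_decode_def)
  qed
  moreover have "primrec_pred 2 (\<lambda>xs. \<exists>q<xs ! 1 + 1. \<exists>r<2 ^ (xs ! 0). xs ! 1 = (2 * q + 1) * 2 ^ (xs ! 0) + r)"
    by (rule primrec_bex primrec_eq primrec_add primrec_mult primrec_power primrec_const primrec_nth |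
        simp)+
  ultimately have "primrec_fun 2 (\<lambda>xs. of_bool (xs ! 0 \<in> set_decode (xs ! 1)))"
    by (simp add: primrec_pred_def)
  from primrec_comp2[OF this assms] show ?thesis
    by (simp add: primrec_pred_def)
qed

section \<open>Automata that read one user at a time\<close>

text \<open>The binary value with the first bit most significant: it can be built while the bits are
  read, using addition only.\<close>

definition horner :: "nat list \<Rightarrow> nat" where
  "horner = foldl (\<lambda>S x. S + S + x) 0"

lemma horner_snoc [simp]: "horner (xs @ [x]) = horner xs + horner xs + x"
  and horner_Nil [simp]: "horner [] = 0"
  by (simp_all add: horner_def)

lemma horner_less: "set xs \<subseteq> {0, 1} \<Longrightarrow> horner xs < 2 ^ length xs"
  by (induction xs rule: rev_induct) auto

text \<open>Register 1 counts the rows left, 2 holds \<open>k\<close>, 3 the state, 4 the budget, 5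
  the value of the bit vector; 6 is auxiliary, 7 counts bits, 8 is reserved for the capped number of
  rows. The two subtractions produce \<open>b - (b - k)\<close>, which is \<open>min b k\<close>
  under truncation.\<close>

definition row_program :: "instr list \<Rightarrow> instr list" where
  "row_program c = [Read 4] ;; [Sub 6 4 2] ;; [Sub 4 4 6] ;; [Const 5 0] ;; move 7 2 ;;
     loop 7 ([Read 6] ;; [Add 5 5 5] ;; [Add 5 5 6]) ;; c ;; move 3 9"

lemma runs_row_program:
  fixes k b :: nat and bits w :: "nat list" and X :: "nat \<Rightarrow> nat"
  assumes c: "computes [2, 3, 4, 5] 9 c (\<lambda>xs. U (xs ! 0) (xs ! 1) (xs ! 2) (xs ! 3)) F"
    and X: "X 2 = k" "length bits = k"
  defines "args \<equiv> [k, X 3, min b k, horner bits]"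
  shows "\<exists>X'. runs (row_program c) X (b # bits @ w) (11 + 6 * k + F args) X' w \<and>
     X' 1 = X 1 \<and> X' 2 = k \<and> X' 3 = U k (X 3) (min b k) (horner bits) \<and> X' 8 = X 8"
proof -
  let ?body = "[Read 6] ;; [Add 5 5 5] ;; [Add 5 5 6]"
  define Y where "Y = X(4 := min b k, 6 := b - k, 5 := 0, 0 := 0, 7 := k)"
  define I where "I j V v \<longleftrightarrow> v = drop j bits @ w \<and> V 7 = k - j \<and> V 5 = horner (take j bits) \<and>
    V 1 = X 1 \<and> V 2 = k \<and> V 3 = X 3 \<and> V 4 = min b k \<and> V 8 = X 8" for j and V :: "nat \<Rightarrow> nat" and v
  have "\<exists>Z v. runs (loop 7 ?body) Y (bits @ w) (3 + (\<Sum>j<k. 3 + 3)) Z v \<and> I k Z v"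
  proof (rule runs_loop)
    show "0 < (7 :: nat)" "I 0 (Y(0 := 1)) (bits @ w)"
      by (simp_all add: I_def Y_def X)
    fix j V v
    show "I j V v \<Longrightarrow> V 7 = k - j"
      by (simp add: I_def)
    assume j: "j < k" and I: "I j V v"
    let ?V = "V(0 := 1, 7 := k - Suc j)"
    have v: "v = bits ! j # drop (Suc j) bits @ w"
      using I j X(2) by (simp add: I_def Cons_nth_drop_Suc)
    have take: "take (Suc j) bits = take j bits @ [bits ! j]"
      using j X(2) by (simp add: take_Suc_conv_app_nth)
    note run = runs_seq[OF runs_Read[of 6 ?V "bits ! j" "drop (Suc j) bits @ w"]
        runs_seq[OF runs_Add[of 5 5 5] runs_Add[of 5 5 6]]]
    show "\<exists>X' w'. runs ?body ?V v 3 X' w' \<and> I (Suc j) X' w'"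
    proof (intro exI conjI)
      show "runs ?body ?V v 3 (?V(6 := bits ! j, 5 := horner (take (Suc j) bits))) (drop (Suc j) bits @ w)"
        unfolding v by (rule runs_eq[OF run]) (use I in \<open>auto simp: I_def take\<close>)
      show "I (Suc j) (?V(6 := bits ! j, 5 := horner (take (Suc j) bits))) (drop (Suc j) bits @ w)"
        using I by (simp add: I_def)
    qed
  qed
  then obtain Z where Z: "runs (loop 7 ?body) Y (bits @ w) (3 + (\<Sum>j<k. 3 + 3)) Z w" "I k Z w"
    using X(2) by (auto simp: I_def)
  have eq: "map Z [2, 3, 4, 5] = args"
    using Z(2) X(2) by (simp add: I_def args_def)
  obtain W where W: "runs c Z w (F args) W w" "W 9 = U k (X 3) (min b k) (horner bits)"
    "\<And>r. 0 < r \<Longrightarrow> r < 9 \<Longrightarrow> W r = Z r"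
    using c[unfolded computes_def, rule_format, of Z w] unfolding eq by (auto simp: args_def)
  have 1: "runs ([Read 4] ;; [Sub 6 4 2] ;; [Sub 4 4 6] ;; [Const 5 0] ;; move 7 2) X (b # bits @ w) 6 Y (bits @ w)"
  proof -
    have "0 < (2 :: nat)" by simp
    note run = runs_seq[OF runs_Read[of 4 X b "bits @ w"] runs_seq[OF runs_Sub[of 6 4 2]
        runs_seq[OF runs_Sub[of 4 4 6] runs_seq[OF runs_Const[of 5 0] runs_move[OF this, of 7]]]]]
    show ?thesis
      by (rule runs_eq[OF run]) (auto simp: Y_def X fun_eq_iff)
  qed
  have "0 < (9 :: nat)" by simp
  note run = runs_seq[OF 1 runs_seq[OF Z(1) runs_seq[OF W(1) runs_move[OF this, of 3]]]]
  have code: "row_program c = ([Read 4] ;; [Sub 6 4 2] ;; [Sub 4 4 6] ;; [Const 5 0] ;; move 7 2) ;;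
      loop 7 ?body ;; c ;; move 3 9"
    by (simp add: row_program_def seq_def o_def add.assoc)
  have "6 + (3 + (\<Sum>j<k. 3 + 3) + (F args + 2)) = 11 + 6 * k + F args"
    by simp
  then have "runs (row_program c) X (b # bits @ w) (11 + 6 * k + F args) (W(0 := 0, 3 := W 9)) w"
    unfolding code by (rule runs_eq[OF run _ refl])
  then show ?thesis
    using Z(2) W(2,3) by (intro exI[of _ "W(0 := 0, 3 := W 9)"]) (simp add: I_def)
qed

text \<open>A user, given by its budget \<open>b\<close> and a bit vector, is one input letter of an automaton
  whose states for parameter \<open>k\<close> are bounded by \<open>A k\<close>. Transitions are evaluated with the
  budget capped at \<open>k\<close>, so that there are only finitely many of them for each \<open>k\<close>, and their
  cost is bounded by the sum of all of these costs.\<close>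

definition run_rows :: "(nat \<Rightarrow> nat \<Rightarrow> nat \<Rightarrow> nat \<Rightarrow> nat) \<Rightarrow> nat \<Rightarrow> nat \<Rightarrow> (nat \<times> nat list) list \<Rightarrow> nat" where
  "run_rows U k = foldl (\<lambda>s (b, bits). U k s (min b k) (horner bits))"

text \<open>The output function sees the number of letters only up to 2, so for each
  \<open>k\<close> it also has finitely many argument tuples, and \<open>q k\<close> bounds its
  cost. The suffix \<open>w\<close> stays on the tape.\<close>

lemma automaton_fpt:
  assumes U: "primrec_fun 4 (\<lambda>xs. U (xs ! 0) (xs ! 1) (xs ! 2) (xs ! 3))"
    and Q: "primrec_fun 3 (\<lambda>xs. Q (xs ! 0) (xs ! 1) (xs ! 2))"
    and A: "primrec_fun 1 (\<lambda>xs. A (xs ! 0))"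
    and bounds: "\<And>k. s0 < A k" "\<And>k s b S. U k s b S < A k"
  shows "\<exists>P f. computable f \<and> (\<forall>k rows w.
     (\<forall>(b, bits) \<in> set rows. length bits = k \<and> set bits \<subseteq> {0, 1}) \<longrightarrow>
     outputs_within P (length rows # k # concat (map (\<lambda>(b, bits). b # bits) rows) @ w)
       (f k * max 1 (length rows)) (Q k (run_rows U k s0 rows) (min (length rows) 2)))"
proof -
  obtain CU where CU: "primrec_cost 4 (\<lambda>xs. U (xs ! 0) (xs ! 1) (xs ! 2) (xs ! 3)) CU"
    using U unfolding primrec_fun_def by blast
  obtain CQ where CQ: "primrec_cost 3 (\<lambda>xs. Q (xs ! 0) (xs ! 1) (xs ! 2)) CQ"
    using Q unfolding primrec_fun_def by blast
  obtain cu where cu: "computes [2, 3, 4, 5] 9 cu (\<lambda>xs. U (xs ! 0) (xs ! 1) (xs ! 2) (xs ! 3)) CU"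
    using primrec_compile[OF CU, of "[2, 3, 4, 5]" 9] by auto
  obtain cq where cq: "computes [2, 3, 8] 9 cq (\<lambda>xs. Q (xs ! 0) (xs ! 1) (xs ! 2)) CQ"
    using primrec_compile[OF CQ, of "[2, 3, 8]" 9] by auto
  define u where "u k = (\<Sum>s<A k. \<Sum>b<k + 1. \<Sum>S<2 ^ k. CU [k, s, b, S])" for k
  define q where "q k = (\<Sum>s<A k. \<Sum>n<3. CQ [k, s, n])" for k
  \<comment> \<open>\<open>14 + 6 * k + u k\<close> bounds one round including the loop overhead,
    \<open>11 + q k\<close> everything outside the rounds.\<close>
  define f where "f k = 25 + 6 * k + u k + q k" for k
  have comp4: "primrec_fun m (\<lambda>xs. CU [f0 xs, f1 xs, f2 xs, f3 xs])"
    if "primrec_fun m f0" "primrec_fun m f1" "primrec_fun m f2" "primrec_fun m f3" for m f0 f1 f2 f3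
    using primrec_comp[of "[f0, f1, f2, f3]" m CU] primrec_primrec_cost[OF CU] that
    by (auto simp: eval_nat_numeral)
  have comp3: "primrec_fun m (\<lambda>xs. CQ [f0 xs, f1 xs, f2 xs])"
    if "primrec_fun m f0" "primrec_fun m f1" "primrec_fun m f2" for m f0 f1 f2
    using primrec_comp[of "[f0, f1, f2]" m CQ] primrec_primrec_cost[OF CQ] that
    by (auto simp: eval_nat_numeral)
  have A': "primrec_fun m (\<lambda>xs. A (g xs))" if "primrec_fun m g" for m g
    by (rule primrec_comp1[OF A that])
  have "primrec_fun 1 (\<lambda>xs. u (xs ! 0))"
    unfolding u_def
    by (rule primrec_sum comp4 A' primrec_add primrec_power primrec_const primrec_nth | simp)+
  moreover have "primrec_fun 1 (\<lambda>xs. q (xs ! 0))"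
    unfolding q_def
    by (rule primrec_sum comp3 A' primrec_const primrec_nth | simp)+
  ultimately have "computable f"
    unfolding f_def
    by (intro primrec_computable primrec_add primrec_mult primrec_const primrec_nth) simp_all
  \<comment> \<open>Register 8 receives \<open>n - (n - 2)\<close>, that is \<open>min n 2\<close>,
    before the loop consumes the count in register 1.\<close>
  define P where "P = [Read 1] ;; [Read 2] ;; [Const 3 s0] ;; [Const 6 2] ;; [Sub 8 1 6] ;;
    [Sub 8 1 8] ;; loop 1 (row_program cu) ;; cq ;; move 0 9"
  have "outputs_within P (length rows # k # concat (map (\<lambda>(b, bits). b # bits) rows) @ w)
       (f k * max 1 (length rows)) (Q k (run_rows U k s0 rows) (min (length rows) 2))"
    if "\<forall>(b, bits) \<in> set rows. length bits = k \<and> set bits \<subseteq> {0, 1}" for k rows w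
  proof -
    have rows: "length bits = k \<and> set bits \<subseteq> {0, 1}" if "(b, bits) \<in> set rows" for b bits
      using \<open>\<forall>(b, bits) \<in> set rows. _\<close> that by auto
    let ?n = "length rows"
    let ?inp = "\<lambda>rows. concat (map (\<lambda>(b, bits). b # bits) rows) @ w"
    define state where "state j = run_rows U k s0 (take j rows)" for j
    define args where "args j = [k, state j, min (fst (rows ! j)) k, horner (snd (rows ! j))]" for j
    have state_Suc: "state (Suc j) = U k (state j) (min (fst (rows ! j)) k) (horner (snd (rows ! j)))"
      if "j < ?n" for j
      using that by (simp add: state_def run_rows_def take_Suc_conv_app_nth case_prod_unfold)
    have state_less: "state j < A k" if "j \<le> ?n" for j
      using that by (cases j) (simp_all add: state_Suc bounds, simp add: state_def run_rows_def bounds)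
    define X where "X = (\<lambda>_ :: nat. 0 :: nat)(1 := ?n, 2 := k, 3 := s0, 6 := 2, 8 := min ?n 2)"
    define I where "I j V v \<longleftrightarrow> v = ?inp (drop j rows) \<and> V 1 = ?n - j \<and> V 2 = k \<and> V 3 = state j \<and>
      V 8 = min ?n 2" for j and V :: "nat \<Rightarrow> nat" and v
    have "\<exists>Y v. runs (loop 1 (row_program cu)) X (?inp rows)
        (3 + (\<Sum>j<?n. 11 + 6 * k + CU (args j) + 3)) Y v \<and> I ?n Y v"
    proof (rule runs_loop)
      show "0 < (1 :: nat)" "I 0 (X(0 := 1)) (?inp rows)"
        by (simp_all add: I_def X_def state_def run_rows_def)
      fix j V v
      show "I j V v \<Longrightarrow> V 1 = ?n - j"
        by (simp add: I_def)
      assume j: "j < ?n" and I: "I j V v"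
      let ?V = "V(0 := 1, 1 := ?n - Suc j)"
      obtain b bits where row: "rows ! j = (b, bits)"
        by fastforce
      then have "length bits = k"
        using rows j nth_mem by metis
      moreover have "v = b # bits @ ?inp (drop (Suc j) rows)"
        using I j row Cons_nth_drop_Suc[OF j, symmetric] by (simp add: I_def)
      ultimately show "\<exists>X' w'. runs (row_program cu) ?V v (11 + 6 * k + CU (args j)) X' w' \<and> I (Suc j) X' w'"
        using runs_row_program[OF cu, of ?V k bits b "?inp (drop (Suc j) rows)"] I j row
        by (auto simp: I_def args_def state_Suc)
    qed
    then obtain Y v where Y: "runs (loop 1 (row_program cu)) X (?inp rows)
        (3 + (\<Sum>j<?n. 11 + 6 * k + CU (args j) + 3)) Y v" "I ?n Y v"
      by blast
    let ?qargs = "[k, state ?n, min ?n 2]"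
    have "map Y [2, 3, 8] = ?qargs"
      using Y(2) by (simp add: I_def)
    then obtain Z where Z: "runs cq Y v (CQ ?qargs) Z v" "Z 9 = Q k (state ?n) (min ?n 2)"
      using cq[unfolded computes_def, rule_format, of Y v] by auto
    have "0 < (9 :: nat)" by simp
    note run2 = runs_seq[OF Y(1) runs_seq[OF Z(1) runs_move[OF this, of 0]]]
    have [simp]: "?n - (?n - 2) = min ?n 2" by simp
    have "runs ([Read 1] ;; [Read 2] ;; [Const 3 s0] ;; [Const 6 2] ;; [Sub 8 1 6] ;; [Sub 8 1 8])
        (\<lambda>_. 0) (?n # k # ?inp rows) 6 X (?inp rows)"
      by (rule runs_eq[OF runs_seq[OF runs_Read[of 1 "\<lambda>_. 0" ?n "k # ?inp rows"] runs_seq[OF runs_Read[of 2]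
          runs_seq[OF runs_Const[of 3 s0] runs_seq[OF runs_Const[of 6 2]
          runs_seq[OF runs_Sub[of 8 1 6] runs_Sub[of 8 1 8]]]]]]]) (auto simp: X_def)
    from runs_seq[OF this run2]
    have run: "runs P (\<lambda>_. 0) (?n # k # ?inp rows)
        (6 + (3 + (\<Sum>j<?n. 11 + 6 * k + CU (args j) + 3) + (CQ ?qargs + 2)))
        (Z(0 := Z 9)) v"
      by (simp add: P_def seq_def o_def add.assoc)
    have CU_le: "CU (args j) \<le> u k" if "j < ?n" for j
    proof -
      have "(fst (rows ! j), snd (rows ! j)) \<in> set rows"
        using that by simp
      then have S: "horner (snd (rows ! j)) < 2 ^ k"
        using rows horner_less by metis
      have "CU (args j) \<le> (\<Sum>S<2 ^ k. CU [k, state j, min (fst (rows ! j)) k, S])"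
        unfolding args_def by (rule member_le_sum[where f = "\<lambda>S. CU [k, state j, min (fst (rows ! j)) k, S]"])
          (use S in auto)
      also have "\<dots> \<le> (\<Sum>b<k + 1. \<Sum>S<2 ^ k. CU [k, state j, b, S])"
        by (rule member_le_sum[where f = "\<lambda>b. \<Sum>S<2 ^ k. CU [k, state j, b, S]"]) auto
      also have "\<dots> \<le> u k"
        unfolding u_def by (rule member_le_sum[where f = "\<lambda>s. \<Sum>b<k + 1. \<Sum>S<2 ^ k. CU [k, s, b, S]"])
          (use that state_less[of j] in auto)
      finally show ?thesis .
    qed
    have CQ_le: "CQ ?qargs \<le> q k"
    proof -
      have "CQ ?qargs \<le> (\<Sum>n<3. CQ [k, state ?n, n])"
        by (rule member_le_sum[where f = "\<lambda>n. CQ [k, state ?n, n]"]) auto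
      also have "\<dots> \<le> q k"
        unfolding q_def by (rule member_le_sum[where f = "\<lambda>s. \<Sum>n<3. CQ [k, s, n]"])
          (use state_less[of ?n] in auto)
      finally show ?thesis .
    qed
    have "(\<Sum>j<?n. 11 + 6 * k + CU (args j) + 3) \<le> (\<Sum>j<?n. 14 + 6 * k + u k)"
      using CU_le by (intro sum_mono) simp
    also have "\<dots> = (14 + 6 * k + u k) * ?n"
      by simp
    also have "\<dots> \<le> (14 + 6 * k + u k) * max 1 ?n"
      by (intro mult_le_mono) simp_all
    finally have "6 + (3 + (\<Sum>j<?n. 11 + 6 * k + CU (args j) + 3) + (CQ ?qargs + 2)) \<le>
        (14 + 6 * k + u k) * max 1 ?n + (11 + q k) * 1"
      using CQ_le by simp
    also have "\<dots> \<le> (14 + 6 * k + u k) * max 1 ?n + (11 + q k) * max 1 ?n"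
      by (intro add_left_mono mult_le_mono) simp_all
    also have "\<dots> = f k * max 1 ?n"
      unfolding f_def add_mult_distrib[symmetric] by (simp add: algebra_simps)
    finally show ?thesis
      using runs_outputs_within[OF run] Z(2) by (simp add: state_def)
  qed
  with \<open>computable f\<close> show ?thesis
    by blast
qed

section \<open>Families of channel sets\<close>

lemma set_decode_sum:
  "set_decode (\<Sum>i<n. of_bool (P i) * 2 ^ i) = {i. i < n \<and> P i}"
proof -
  have "(\<Sum>i<n. of_bool (P i) * 2 ^ i) = set_encode {i. i < n \<and> P i}"
    unfolding set_encode_def by (rule sum.mono_neutral_cong_right) auto
  then show ?thesis
    by (simp add: set_encode_inverse)
qed

text \<open>Applied with exponents \<open>k\<close>, \<open>2 ^ k\<close> and
  \<open>2 ^ 2 ^ k\<close>, for codes of channel sets, families and states.\<close>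

lemma set_decode_subset_iff: "set_decode x \<subseteq> {..<k} \<longleftrightarrow> x < 2 ^ k"
proof
  assume "set_decode x \<subseteq> {..<k}"
  then have "set_encode (set_decode x) \<le> (\<Sum>i<k. 2 ^ i)"
    unfolding set_encode_def by (intro sum_mono2) auto
  also have "\<dots> < 2 ^ k"
    by (induction k) auto
  finally show "x < 2 ^ k"
    by simp
next
  assume x: "x < 2 ^ k"
  show "set_decode x \<subseteq> {..<k}"
  proof
    fix i assume "i \<in> set_decode x"
    then have "x div 2 ^ i \<noteq> 0"
      by (auto simp: set_decode_def elim: oddE)
    then have "2 ^ i \<le> x"
      by (meson div_less not_le)
    then have "(2 :: nat) ^ i < 2 ^ k"
      using x by (rule le_less_trans)
    then show "i \<in> {..<k}"
      by simp
  qed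
qed

lemma inj_set_decode: "inj set_decode"
  by (metis injI set_decode_inverse)

lemma set_decode_less: "i \<in> set_decode x \<Longrightarrow> x < 2 ^ k \<Longrightarrow> i < k"
  using set_decode_subset_iff by blast

lemma set_decode_onto:
  assumes "A \<subseteq> {..<k}"
  obtains a where "a < 2 ^ k" "set_decode a = A"
proof
  show "set_decode (set_encode A) = A"
    using assms by (intro set_encode_inverse) (rule finite_subset, auto)
  with assms show "set_encode A < 2 ^ k"
    using set_decode_subset_iff[of "set_encode A" k] by simp
qed

definition decode_family :: "nat \<Rightarrow> nat set set" where
  "decode_family F = set_decode ` set_decode F"

lemma set_decode_mem_decode_family [simp]: "set_decode A \<in> decode_family F \<longleftrightarrow> A \<in> set_decode F"
  unfolding decode_family_def by (rule inj_image_mem_iff[OF inj_set_decode])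

lemma decode_family_eq_iff [simp]: "decode_family F = decode_family G \<longleftrightarrow> F = G"
  unfolding decode_family_def inj_image_eq_iff[OF inj_set_decode]
  by (metis set_decode_inverse)

lemma decode_family_0 [simp]: "decode_family 0 = {}"
  by (simp add: decode_family_def)

lemma decode_family_subset: "F < 2 ^ 2 ^ k \<Longrightarrow> decode_family F \<subseteq> Pow {..<k}"
  using set_decode_less set_decode_subset_iff unfolding decode_family_def by blast

lemma decode_family_onto:
  assumes "\<A> \<subseteq> Pow {..<k}"
  obtains F where "F < 2 ^ 2 ^ k" "decode_family F = \<A>"
proof -
  have "{a. set_decode a \<in> \<A>} \<subseteq> {..<2 ^ k}"
    using assms set_decode_subset_iff by blast
  then obtain F where F: "F < 2 ^ 2 ^ k" "set_decode F = {a. set_decode a \<in> \<A>}"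
    by (rule set_decode_onto)
  moreover have "decode_family F = \<A>"
  proof
    show "\<A> \<subseteq> decode_family F"
    proof
      fix A assume "A \<in> \<A>"
      then obtain a where "set_decode a = A"
        using assms set_decode_onto[of A k] by blast
      then show "A \<in> decode_family F"
        using \<open>A \<in> \<A>\<close> F(2) by (auto simp: decode_family_def)
    qed
  qed (auto simp: decode_family_def F(2))
  ultimately show thesis
    using that by blast
qed

text \<open>A state codes the set of all families that arise as the range of a spectrum assignment
  on the users read so far.\<close>

definition families :: "nat \<Rightarrow> nat set set set" where
  "families s = decode_family ` set_decode s"

text \<open>Written with bit tests, sums and bounded quantifiers only, so that primitive
  recursiveness can be read off the shape of the term. \<open>F'\<close> is a candidate for the new
  family, \<open>A\<close> the channel set of the new user, and the inner sum is the size of that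
  set.\<close>

definition add_user :: "nat \<Rightarrow> nat \<Rightarrow> nat \<Rightarrow> nat \<Rightarrow> nat" where
  "add_user k s b S = (\<Sum>F'<2 ^ 2 ^ k. of_bool (\<exists>F<2 ^ 2 ^ k. F \<in> set_decode s \<and> (\<exists>A<2 ^ k.
     (\<forall>c<k. c \<in> set_decode A \<longrightarrow> c \<in> set_decode S) \<and> (\<Sum>c<k. of_bool (c \<in> set_decode A)) \<le> b \<and>
     (\<forall>B<2 ^ k. B \<in> set_decode F' \<longleftrightarrow> B \<in> set_decode F \<or> B = A))) * 2 ^ F')"

lemma add_user_less: "add_user k s b S < 2 ^ 2 ^ 2 ^ k"
proof -
  have "set_decode (add_user k s b S) \<subseteq> {..<2 ^ 2 ^ k}"
    unfolding add_user_def set_decode_sum by blast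
  then show ?thesis
    by (simp only: set_decode_subset_iff)
qed

text \<open>The bounds on \<open>s\<close> and \<open>S\<close> ensure that no family or channel set
  escapes the bounded quantifiers; conversely each extended family still lies in
  \<open>Pow {..<k}\<close> and so has a code in range.\<close>

lemma families_add_user:
  assumes "s < 2 ^ 2 ^ 2 ^ k" "S < 2 ^ k"
  shows "families (add_user k s b S) =
    {insert A \<A> | A \<A>. \<A> \<in> families s \<and> A \<subseteq> set_decode S \<and> card A \<le> b}"
proof -
  have step: "(\<forall>c<k. c \<in> set_decode A \<longrightarrow> c \<in> set_decode S) \<and> (\<Sum>c<k. of_bool (c \<in> set_decode A)) \<le> b \<and>
      (\<forall>B<2 ^ k. B \<in> set_decode F' \<longleftrightarrow> B \<in> set_decode F \<or> B = A) \<longleftrightarrow>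
      set_decode A \<subseteq> set_decode S \<and> card (set_decode A) \<le> b \<and>
      decode_family F' = insert (set_decode A) (decode_family F)"
    if "A < 2 ^ k" "F < 2 ^ 2 ^ k" "F' < 2 ^ 2 ^ k" for A F F'
  proof -
    have "(\<forall>c<k. c \<in> set_decode A \<longrightarrow> c \<in> set_decode S) \<longleftrightarrow> set_decode A \<subseteq> set_decode S"
      using set_decode_less[OF _ that(1)] by blast
    moreover have "{..<k} \<inter> {c. c \<in> set_decode A} = set_decode A"
      using set_decode_less[OF _ that(1)] by blast
    then have "(\<Sum>c<k. of_bool (c \<in> set_decode A)) = card (set_decode A)"
      by simp
    moreover have "(\<forall>B<2 ^ k. B \<in> set_decode F' \<longleftrightarrow> B \<in> set_decode F \<or> B = A) \<longleftrightarrow>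
        set_decode F' = insert A (set_decode F)"
      using set_decode_less[OF _ that(2)] set_decode_less[OF _ that(3)] that(1) by blast
    moreover have "\<dots> \<longleftrightarrow> decode_family F' = insert (set_decode A) (decode_family F)"
      unfolding decode_family_def image_insert[symmetric] inj_image_eq_iff[OF inj_set_decode] ..
    ultimately show ?thesis
      by metis
  qed
  have "set_decode (add_user k s b S) = {F'. F' < 2 ^ 2 ^ k \<and> (\<exists>F<2 ^ 2 ^ k. F \<in> set_decode s \<and>
      (\<exists>A<2 ^ k. set_decode A \<subseteq> set_decode S \<and> card (set_decode A) \<le> b \<and>
       decode_family F' = insert (set_decode A) (decode_family F)))}"
    unfolding add_user_def set_decode_sum
    by (rule Collect_cong, rule conj_cong[OF refl], rule ex_cong1, rule conj_cong[OF refl],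
        rule conj_cong[OF refl], rule ex_cong1, rule conj_cong[OF refl], rule step)
  note eq = this
  show ?thesis
  proof (intro equalityI subsetI)
    fix \<B> assume "\<B> \<in> families (add_user k s b S)"
    then show "\<B> \<in> {insert A \<A> | A \<A>. \<A> \<in> families s \<and> A \<subseteq> set_decode S \<and> card A \<le> b}"
      unfolding families_def eq by blast
  next
    fix \<B> assume "\<B> \<in> {insert A \<A> | A \<A>. \<A> \<in> families s \<and> A \<subseteq> set_decode S \<and> card A \<le> b}"
    then obtain A F where F: "F \<in> set_decode s" and A: "A \<subseteq> set_decode S" "card A \<le> b"
      and \<B>: "\<B> = insert A (decode_family F)"
      unfolding families_def by blast
    have "F < 2 ^ 2 ^ k"
      using F assms(1) by (rule set_decode_less)
    have "A \<subseteq> {..<k}"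
      using A(1) assms(2) set_decode_subset_iff by blast
    then obtain a where a: "a < 2 ^ k" "set_decode a = A"
      by (rule set_decode_onto)
    have "\<B> \<subseteq> Pow {..<k}"
      using \<B> \<open>A \<subseteq> {..<k}\<close> decode_family_subset[OF \<open>F < 2 ^ 2 ^ k\<close>] by simp
    then obtain F' where "F' < 2 ^ 2 ^ k" "decode_family F' = \<B>"
      by (rule decode_family_onto)
    moreover from this have "F' \<in> set_decode (add_user k s b S)"
      unfolding eq using F \<open>F < 2 ^ 2 ^ k\<close> a A \<B> by blast
    ultimately show "\<B> \<in> families (add_user k s b S)"
      unfolding families_def by blast
  qed
qed

text \<open>The bit read last has weight 1, whence \<open>rev\<close>.\<close>

lemma set_decode_horner:
  "set bits \<subseteq> {0, 1} \<Longrightarrow> set_decode (horner bits) = {i. i < length bits \<and> rev bits ! i = 1}"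
proof (induction bits rule: rev_induct)
  case (snoc x bits)
  show ?case
  proof (rule set_eqI)
    fix i
    have "x = 0 \<or> x = 1"
      using snoc.prems by auto
    then have "(horner bits + horner bits + x) div 2 = horner bits"
      "odd (horner bits + horner bits + x) \<longleftrightarrow> x = 1"
      by auto
    then show "i \<in> set_decode (horner (bits @ [x])) \<longleftrightarrow>
        i \<in> {i. i < length (bits @ [x]) \<and> rev (bits @ [x]) ! i = 1}"
      using snoc by (cases i) (simp_all add: set_decode_0 set_decode_Suc)
  qed
qed simp

lemma families_run_rows:
  assumes "distinct us" "\<And>u. u \<in> set us \<Longrightarrow> length (bits u) = k \<and> set (bits u) \<subseteq> {0, 1}"
  shows "families (run_rows add_user k 1 (map (\<lambda>u. (b u, bits u)) us)) =
    {SA ` set us | SA. \<forall>u\<in>set us. SA u \<subseteq> set_decode (horner (bits u)) \<and> card (SA u) \<le> b u} \<and>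
    run_rows add_user k 1 (map (\<lambda>u. (b u, bits u)) us) < 2 ^ 2 ^ 2 ^ k"
  using assms
proof (induction us rule: rev_induct)
  case Nil
  \<comment> \<open>The initial state 1 contains just the empty family, which is the range of an
    assignment on no users.\<close>
  have "set_decode 1 = {0}"
    using set_encode_inverse[of "{0}"] by (simp add: set_encode_def)
  moreover have "1 < (2 :: nat) ^ 2 ^ 2 ^ k"
    by (rule one_less_power) simp_all
  ultimately show ?case
    by (simp add: run_rows_def families_def decode_family_def)
next
  case (snoc u us)
  let ?s = "run_rows add_user k 1 (map (\<lambda>u. (b u, bits u)) us)"
  let ?T = "\<lambda>u. set_decode (horner (bits u))"
  have IH: "families ?s = {SA ` set us | SA. \<forall>u\<in>set us. SA u \<subseteq> ?T u \<and> card (SA u) \<le> b u}"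
    "?s < 2 ^ 2 ^ 2 ^ k"
    using snoc by auto
  have u: "horner (bits u) < 2 ^ k" "u \<notin> set us"
    using horner_less[of "bits u"] snoc.prems by auto
  \<comment> \<open>A set of channels has at most \<open>k\<close> elements, so the cap on the
    budget excludes nothing.\<close>
  have card: "card A \<le> min (b u) k \<longleftrightarrow> card A \<le> b u" if "A \<subseteq> ?T u" for A
  proof -
    have "A \<subseteq> {..<k}"
      using that u(1) set_decode_subset_iff by blast
    then have "card A \<le> k"
      using card_mono[of "{..<k}" A] by simp
    then show ?thesis
      by simp
  qed
  have run: "run_rows add_user k 1 (map (\<lambda>u. (b u, bits u)) (us @ [u])) =
      add_user k ?s (min (b u) k) (horner (bits u))"
    by (simp add: run_rows_def)
  have "families (add_user k ?s (min (b u) k) (horner (bits u))) =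
      {insert A \<A> | A \<A>. \<A> \<in> families ?s \<and> A \<subseteq> ?T u \<and> card A \<le> b u}"
    unfolding families_add_user[OF IH(2) u(1)] using card by blast
  also have "\<dots> = {SA ` set (us @ [u]) | SA. \<forall>u\<in>set (us @ [u]). SA u \<subseteq> ?T u \<and> card (SA u) \<le> b u}"
  proof (intro equalityI subsetI)
    fix \<B> assume "\<B> \<in> {insert A \<A> | A \<A>. \<A> \<in> families ?s \<and> A \<subseteq> ?T u \<and> card A \<le> b u}"
    then obtain A SA where A: "A \<subseteq> ?T u" "card A \<le> b u" and \<B>: "\<B> = insert A (SA ` set us)"
      and SA: "\<forall>u\<in>set us. SA u \<subseteq> ?T u \<and> card (SA u) \<le> b u"
      unfolding IH(1) by blast
    have "\<B> = (SA(u := A)) ` set (us @ [u])"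
      using u(2) \<B> by auto
    moreover have "\<forall>v\<in>set (us @ [u]). (SA(u := A)) v \<subseteq> ?T v \<and> card ((SA(u := A)) v) \<le> b v"
      using A SA by auto
    ultimately show "\<B> \<in> {SA ` set (us @ [u]) | SA. \<forall>u\<in>set (us @ [u]). SA u \<subseteq> ?T u \<and> card (SA u) \<le> b u}"
      by blast
  next
    fix \<B> assume "\<B> \<in> {SA ` set (us @ [u]) | SA. \<forall>u\<in>set (us @ [u]). SA u \<subseteq> ?T u \<and> card (SA u) \<le> b u}"
    then obtain SA where "\<B> = insert (SA u) (SA ` set us)"
      "\<forall>u\<in>set (us @ [u]). SA u \<subseteq> ?T u \<and> card (SA u) \<le> b u"
      by auto
    then show "\<B> \<in> {insert A \<A> | A \<A>. \<A> \<in> families ?s \<and> A \<subseteq> ?T u \<and> card A \<le> b u}"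
      unfolding IH(1) by auto
  qed
  finally show ?case
    unfolding run using add_user_less by blast
qed

text \<open>Connectedness of the intersection graph, stated by cuts instead of paths so that it
  quantifies over subfamilies only. The empty set is excluded explicitly: the family
  \<open>{{}}\<close> has no proper cut, yet several users without channels are isolated.\<close>

definition linked :: "'a set set \<Rightarrow> bool" where
  "linked \<A> \<longleftrightarrow> {} \<notin> \<A> \<and>
     (\<forall>\<G>\<subseteq>\<A>. \<G> \<noteq> {} \<longrightarrow> \<G> \<noteq> \<A> \<longrightarrow> (\<exists>A\<in>\<G>. \<exists>B\<in>\<A> - \<G>. A \<inter> B \<noteq> {}))"

definition accept :: "nat \<Rightarrow> nat \<Rightarrow> nat \<Rightarrow> nat" where
  "accept k s n = of_bool (n = 1 \<or> n = 2 \<and> (\<exists>F<2 ^ 2 ^ k. F \<in> set_decode s \<and> \<not> 0 \<in> set_decode F \<and>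
     (\<forall>G<2 ^ 2 ^ k. (\<forall>A<2 ^ k. A \<in> set_decode G \<longrightarrow> A \<in> set_decode F) \<longrightarrow> \<not> G = 0 \<longrightarrow> \<not> G = F \<longrightarrow>
       (\<exists>A<2 ^ k. \<exists>B<2 ^ k. A \<in> set_decode G \<and> B \<in> set_decode F \<and> \<not> B \<in> set_decode G \<and>
         (\<exists>c<k. c \<in> set_decode A \<and> c \<in> set_decode B)))))"

text \<open>Every subfamily again lies in \<open>Pow {..<k}\<close>, so the cuts are exactly those
  coded by some \<open>G\<close> within the bound. The number 0 codes both the empty set and the
  empty family.\<close>

lemma linked_decode_family:
  assumes F: "F < 2 ^ 2 ^ k"
  shows "linked (decode_family F) \<longleftrightarrow> \<not> 0 \<in> set_decode F \<and>
     (\<forall>G<2 ^ 2 ^ k. (\<forall>A<2 ^ k. A \<in> set_decode G \<longrightarrow> A \<in> set_decode F) \<longrightarrow> \<not> G = 0 \<longrightarrow> \<not> G = F \<longrightarrow>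
       (\<exists>A<2 ^ k. \<exists>B<2 ^ k. A \<in> set_decode G \<and> B \<in> set_decode F \<and> \<not> B \<in> set_decode G \<and>
         (\<exists>c<k. c \<in> set_decode A \<and> c \<in> set_decode B)))"
    (is "_ \<longleftrightarrow> _ \<and> (\<forall>G<_. ?sub G \<longrightarrow> _ \<longrightarrow> _ \<longrightarrow> ?cross G)")
proof -
  have empty: "{} \<in> decode_family F \<longleftrightarrow> 0 \<in> set_decode F"
    using set_decode_mem_decode_family[of 0 F] by simp
  have sub: "?sub G \<longleftrightarrow> decode_family G \<subseteq> decode_family F" if "G < 2 ^ 2 ^ k" for G
    unfolding decode_family_def inj_image_subset_iff[OF inj_set_decode]
    using set_decode_less[OF _ that] by blast
  have cross: "?cross G \<longleftrightarrow>
      (\<exists>A\<in>decode_family G. \<exists>B\<in>decode_family F - decode_family G. A \<inter> B \<noteq> {})" if "G < 2 ^ 2 ^ k" for G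
  proof
    assume "?cross G"
    then obtain A B c where "A \<in> set_decode G" "B \<in> set_decode F" "B \<notin> set_decode G"
      "c \<in> set_decode A" "c \<in> set_decode B"
      by blast
    then show "\<exists>A\<in>decode_family G. \<exists>B\<in>decode_family F - decode_family G. A \<inter> B \<noteq> {}"
      by (intro bexI[of _ "set_decode A"] bexI[of _ "set_decode B"]) auto
  next
    assume "\<exists>A\<in>decode_family G. \<exists>B\<in>decode_family F - decode_family G. A \<inter> B \<noteq> {}"
    then obtain A B c where AB: "A \<in> set_decode G" "B \<in> set_decode F" "B \<notin> set_decode G"
      "c \<in> set_decode A" "c \<in> set_decode B"
      unfolding decode_family_def by blast
    then have "A < 2 ^ k" "B < 2 ^ k"
      using that F set_decode_less by blast+
    moreover from this have "c < k"
      using AB set_decode_less by blast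
    ultimately show "?cross G"
      using AB by blast
  qed
  have "(\<forall>\<G>\<subseteq>decode_family F. \<G> \<noteq> {} \<longrightarrow> \<G> \<noteq> decode_family F \<longrightarrow>
        (\<exists>A\<in>\<G>. \<exists>B\<in>decode_family F - \<G>. A \<inter> B \<noteq> {})) \<longleftrightarrow>
      (\<forall>G<2 ^ 2 ^ k. decode_family G \<subseteq> decode_family F \<longrightarrow> decode_family G \<noteq> {} \<longrightarrow>
        decode_family G \<noteq> decode_family F \<longrightarrow>
        (\<exists>A\<in>decode_family G. \<exists>B\<in>decode_family F - decode_family G. A \<inter> B \<noteq> {}))"
    (is "?L \<longleftrightarrow> ?R")
  proof
    assume R: ?R
    show ?L
    proof (intro allI impI)
      fix \<G> assume \<G>: "\<G> \<subseteq> decode_family F" "\<G> \<noteq> {}" "\<G> \<noteq> decode_family F"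
      then have "\<G> \<subseteq> Pow {..<k}"
        using decode_family_subset[OF F] by blast
      then obtain G where "G < 2 ^ 2 ^ k" "decode_family G = \<G>"
        by (rule decode_family_onto)
      with R \<G> show "\<exists>A\<in>\<G>. \<exists>B\<in>decode_family F - \<G>. A \<inter> B \<noteq> {}"
        by blast
    qed
  qed blast
  moreover have "decode_family G = {} \<longleftrightarrow> G = 0" for G
    using decode_family_eq_iff[of G 0] by simp
  ultimately show ?thesis
    unfolding linked_def empty using sub cross by simp
qed

lemma accept_eq:
  assumes "s < 2 ^ 2 ^ 2 ^ k"
  shows "accept k s n = of_bool (n = 1 \<or> n = 2 \<and> (\<exists>\<A>\<in>families s. linked \<A>))"
  unfolding accept_def families_def
  using set_decode_less[OF _ assms] linked_decode_family[of _ k] by (auto simp del: of_bool_eq_iff intro!: arg_cong[where f = of_bool])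

lemma primrec_iff:
  assumes "primrec_pred m P" "primrec_pred m Q"
  shows "primrec_pred m (\<lambda>xs. P xs \<longleftrightarrow> Q xs)"
proof -
  have "primrec_pred m (\<lambda>xs. (P xs \<longrightarrow> Q xs) \<and> (Q xs \<longrightarrow> P xs))"
    by (intro primrec_conj primrec_imp assms)
  then show ?thesis
    by (rule primrec_pred_cong) blast
qed

lemmas primrec_intros = primrec_sum primrec_bex primrec_ball primrec_conj primrec_disj primrec_not primrec_imp
  primrec_iff primrec_le primrec_eq primrec_bit primrec_of_bool primrec_mult primrec_power primrec_add
  primrec_const primrec_nth

lemma primrec_add_user: "primrec_fun 4 (\<lambda>xs. add_user (xs ! 0) (xs ! 1) (xs ! 2) (xs ! 3))"
  unfolding add_user_def by (rule primrec_intros | simp)+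

lemma primrec_accept: "primrec_fun 3 (\<lambda>xs. accept (xs ! 0) (xs ! 1) (xs ! 2))"
  unfolding accept_def by (rule primrec_intros | simp)+

section \<open>Spectrum connectivity on complete potential graphs\<close>

definition overlap_connected :: "'u set \<Rightarrow> ('u \<Rightarrow> 'c set) \<Rightarrow> bool" where
  "overlap_connected U SA \<longleftrightarrow> U \<noteq> {} \<and>
     (\<forall>u\<in>U. \<forall>v\<in>U. (u, v) \<in> {(u, v). u \<in> U \<and> v \<in> U \<and> u \<noteq> v \<and> SA u \<inter> SA v \<noteq> {}}\<^sup>*)"

text \<open>The realized arcs already form a symmetric relation, so the symmetric closure in the
  library's notion of connectedness adds nothing; all arcs stay among the users, so reachability is
  the plain reflexive transitive closure.\<close>

lemma connected_realization_graph:
  assumes "complete_potential_graph N"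
  shows "Digraph_Component.connected (with_proj (realization_graph N SA)) \<longleftrightarrow>
    overlap_connected (users N) SA"
proof -
  let ?R = "{(u, v). u \<in> users N \<and> v \<in> users N \<and> u \<noteq> v \<and> SA u \<inter> SA v \<noteq> {}}"
  have "parcs (PG N) = {(u, v). (u, v) \<in> users N \<times> users N \<and> u \<noteq> v}"
    using assms unfolding complete_potential_graph_def complete_digraph_pair_def by blast
  then have "parcs (realization_graph N SA) = ?R"
    unfolding realization_graph_def by simp
  moreover have "(\<Union>e\<in>R. {(fst e, snd e), (snd e, fst e)}) = R \<union> R\<inverse>" for R :: "('a \<times> 'a) set"
    by force
  moreover have "?R\<inverse> = ?R"
    by (simp add: sym_conv_converse_eq[symmetric] sym_def Int_commute) blast
  ultimately have "parcs (mk_symmetric (with_proj (realization_graph N SA))) = ?R"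
    by (simp add: parcs_mk_symmetric)
  moreover have "(u, v) \<in> rtrancl_on (users N) ?R \<longleftrightarrow> (u, v) \<in> ?R\<^sup>*"
    if "u \<in> users N" "v \<in> users N" for u v
  proof
    assume "(u, v) \<in> ?R\<^sup>*"
    then show "(u, v) \<in> rtrancl_on (users N) ?R"
      by (rule rtrancl_consistent_rtrancl_on) (use that in auto)
  qed (rule rtrancl_on_rtranclI)
  ultimately show ?thesis
    by (simp add: Digraph_Component.connected_def strongly_connected_def reachable_def
        overlap_connected_def realization_graph_def)
qed

lemma overlap_connected_cong:
  assumes "\<And>u v. u \<in> U \<Longrightarrow> v \<in> U \<Longrightarrow> SA u \<inter> SA v \<noteq> {} \<longleftrightarrow> SA' u \<inter> SA' v \<noteq> {}"
  shows "overlap_connected U SA \<longleftrightarrow> overlap_connected U SA'"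
proof -
  have "{(u, v). u \<in> U \<and> v \<in> U \<and> u \<noteq> v \<and> SA u \<inter> SA v \<noteq> {}} =
      {(u, v). u \<in> U \<and> v \<in> U \<and> u \<noteq> v \<and> SA' u \<inter> SA' v \<noteq> {}}"
    using assms by blast
  then show ?thesis
    unfolding overlap_connected_def by simp
qed

text \<open>Users with the same nonempty channel set are adjacent, so connectivity depends only on
  the family of sets in use.\<close>

lemma overlap_connected_iff_linked:
  assumes "a \<in> U" "b \<in> U" "a \<noteq> b"
  shows "overlap_connected U SA \<longleftrightarrow> linked (SA ` U)"
proof
  let ?R = "{(u, v). u \<in> U \<and> v \<in> U \<and> u \<noteq> v \<and> SA u \<inter> SA v \<noteq> {}}"
  assume con: "overlap_connected U SA"
  \<comment> \<open>A second user exists, and the first edge of a path towards it shows a channel in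
    \<open>SA u\<close>.\<close>
  have "SA u \<noteq> {}" if "u \<in> U" for u
  proof -
    obtain v where "v \<in> U" "u \<noteq> v"
      using assms by metis
    with con that have "(u, v) \<in> ?R\<^sup>*"
      unfolding overlap_connected_def by blast
    then show "SA u \<noteq> {}"
      by (cases rule: converse_rtranclE) (use \<open>u \<noteq> v\<close> in auto)
  qed
  moreover have "\<exists>A\<in>\<G>. \<exists>B\<in>SA ` U - \<G>. A \<inter> B \<noteq> {}"
    if \<G>: "\<G> \<subseteq> SA ` U" "\<G> \<noteq> {}" "\<G> \<noteq> SA ` U" for \<G>
  proof (rule ccontr)
    assume no: "\<not> ?thesis"
    obtain u v where uv: "u \<in> U" "SA u \<in> \<G>" "v \<in> U" "SA v \<notin> \<G>"
      using \<G> by blast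
    then have "(u, v) \<in> ?R\<^sup>*"
      using con unfolding overlap_connected_def by blast
    then have "SA v \<in> \<G>"
    proof (induction rule: rtrancl_induct)
      case (step w z)
      then have "z \<in> U" "SA w \<inter> SA z \<noteq> {}"
        by auto
      then show ?case
        using no step.IH by blast
    qed (fact uv)
    with uv show False
      by blast
  qed
  ultimately show "linked (SA ` U)"
    unfolding linked_def by blast
next
  let ?R = "{(u, v). u \<in> U \<and> v \<in> U \<and> u \<noteq> v \<and> SA u \<inter> SA v \<noteq> {}}"
  assume linked: "linked (SA ` U)"
  have "(u, v) \<in> ?R\<^sup>*" if "u \<in> U" "v \<in> U" for u v
  proof -
    \<comment> \<open>The family used on the component of \<open>u\<close> meets no other set of the
      family, so it is the whole family. Thus \<open>v\<close> has the same nonempty channel set as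
      some reachable \<open>w\<close> and is reached from it.\<close>
    define W where "W = {w \<in> U. (u, w) \<in> ?R\<^sup>*}"
    have extend: "z \<in> W" if "w \<in> W" "z \<in> U" "SA w \<inter> SA z \<noteq> {}" for w z
    proof (cases "w = z")
      case False
      then have "(w, z) \<in> ?R"
        using that unfolding W_def by blast
      then show ?thesis
        using that by (simp add: W_def rtrancl.rtrancl_into_rtrancl)
    qed (use that in simp)
    have "SA ` W \<noteq> {}"
      using \<open>u \<in> U\<close> unfolding W_def by blast
    moreover have "\<not> (\<exists>A\<in>SA ` W. \<exists>B\<in>SA ` U - SA ` W. A \<inter> B \<noteq> {})"
    proof
      assume "\<exists>A\<in>SA ` W. \<exists>B\<in>SA ` U - SA ` W. A \<inter> B \<noteq> {}"
      then obtain w z where "w \<in> W" "z \<in> U" "SA z \<notin> SA ` W" "SA w \<inter> SA z \<noteq> {}"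
        by blast
      with extend[of w z] show False
        by blast
    qed
    moreover have "SA ` W \<subseteq> SA ` U"
      unfolding W_def by blast
    ultimately have "SA ` W = SA ` U"
      using linked[unfolded linked_def, THEN conjunct2, rule_format, of "SA ` W"] by blast
    then obtain w where w: "w \<in> W" "SA v = SA w"
      using \<open>v \<in> U\<close> by blast
    have "SA v \<noteq> {}"
      using linked \<open>v \<in> U\<close> unfolding linked_def by blast
    then show ?thesis
      using extend[OF w(1) \<open>v \<in> U\<close>] w(2) by (simp add: W_def)
  qed
  then show "overlap_connected U SA"
    using assms(1) unfolding overlap_connected_def by blast
qed

text \<open>Assignments are carried along \<open>h\<close> in both directions: injectivity preserves
  cardinalities and which sets meet. Channels thereby become bit positions.\<close>

lemma connectable_relabel:
  assumes "complete_potential_graph N" and h: "inj_on h {..<k}" "h ` {..<k} = channels N"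
    and sub: "\<And>u. u \<in> users N \<Longrightarrow> SpecMap N u \<subseteq> channels N"
  shows "connectable N \<longleftrightarrow>
    (\<exists>SA. (\<forall>u\<in>users N. SA u \<subseteq> {i. i < k \<and> h i \<in> SpecMap N u} \<and> card (SA u) \<le> budget N u) \<and>
       overlap_connected (users N) SA)"
    (is "_ \<longleftrightarrow> (\<exists>SA. ?valid SA \<and> _)")
proof
  assume "connectable N"
  then obtain SA where SA: "spectrum_assignment N SA" "overlap_connected (users N) SA"
    unfolding connectable_def connected_realization_graph[OF assms(1)] by blast
  define SA' where "SA' u = {i. i < k \<and> h i \<in> SA u}" for u
  have image: "h ` SA' u = SA u" if "u \<in> users N" for u
  proof -
    have "SA u \<subseteq> h ` {..<k}"
      unfolding h(2) using SA(1) sub[OF that] that unfolding spectrum_assignment_def by blast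
    then show ?thesis
      unfolding SA'_def by blast
  qed
  have inj: "inj_on h (SA' u)" for u
    using h(1) by (rule inj_on_subset) (auto simp: SA'_def)
  have "?valid SA'"
  proof
    fix u assume u: "u \<in> users N"
    have "card (SA' u) = card (SA u)"
      using card_image[OF inj[of u]] image[OF u] by simp
    moreover have "SA u \<subseteq> SpecMap N u" "card (SA u) \<le> budget N u"
      using SA(1) u by (simp_all add: spectrum_assignment_def)
    ultimately show "SA' u \<subseteq> {i. i < k \<and> h i \<in> SpecMap N u} \<and> card (SA' u) \<le> budget N u"
      unfolding SA'_def by auto
  qed
  moreover have "overlap_connected (users N) SA'"
  proof (rule overlap_connected_cong[THEN iffD2, OF _ SA(2)])
    fix u v assume "u \<in> users N" "v \<in> users N"
    then have "SA u = h ` SA' u" "SA v = h ` SA' v"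
      using image by simp_all
    moreover have "h ` SA' u \<inter> h ` SA' v = h ` (SA' u \<inter> SA' v)"
      by (rule inj_on_image_Int[OF h(1), symmetric]) (auto simp: SA'_def)
    ultimately show "SA' u \<inter> SA' v \<noteq> {} \<longleftrightarrow> SA u \<inter> SA v \<noteq> {}"
      by simp
  qed
  ultimately show "\<exists>SA. ?valid SA \<and> overlap_connected (users N) SA"
    by (intro exI conjI)
next
  assume "\<exists>SA. ?valid SA \<and> overlap_connected (users N) SA"
  then obtain SA where SA: "?valid SA" "overlap_connected (users N) SA"
    by (elim exE conjE) (rule that)
  have inj: "inj_on h (SA u)" if "u \<in> users N" for u
    using h(1) by (rule inj_on_subset) (use SA(1) that in blast)
  have "spectrum_assignment N (\<lambda>u. h ` SA u)"
    unfolding spectrum_assignment_def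
  proof
    fix u assume u: "u \<in> users N"
    then have "SA u \<subseteq> {i. i < k \<and> h i \<in> SpecMap N u}" "card (SA u) \<le> budget N u"
      using SA(1) by auto
    then show "h ` SA u \<subseteq> SpecMap N u \<and> card (h ` SA u) \<le> budget N u"
      unfolding card_image[OF inj[OF u]] by blast
  qed
  moreover have "overlap_connected (users N) (\<lambda>u. h ` SA u)"
  proof (rule overlap_connected_cong[THEN iffD2, OF _ SA(2)])
    fix u v assume "u \<in> users N" "v \<in> users N"
    then have "SA u \<subseteq> {..<k}" "SA v \<subseteq> {..<k}"
      using SA(1) by blast+
    then show "h ` SA u \<inter> h ` SA v \<noteq> {} \<longleftrightarrow> SA u \<inter> SA v \<noteq> {}"
      by (simp flip: inj_on_image_Int[OF h(1)])
  qed
  ultimately show "connectable N"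
    unfolding connectable_def connected_realization_graph[OF assms(1)] by blast
qed

lemma accept_network:
  assumes "cognitive_radio_network N" "complete_potential_graph N"
    and us: "distinct us" "set us = users N" and cs: "distinct cs" "set cs = channels N"
  shows "accept (length cs) (run_rows add_user (length cs) 1
      (map (\<lambda>u. (budget N u, map (\<lambda>c. if c \<in> SpecMap N u then 1 else 0) cs)) us)) (min (length us) 2) =
    (if connectable N then 1 else 0)"
proof -
  let ?bits = "\<lambda>u. map (\<lambda>c. if c \<in> SpecMap N u then 1 else 0 :: nat) cs"
  let ?k = "length cs"
  \<comment> \<open>Bit \<open>i\<close> of the Horner value belongs to the channel at position
    \<open>i\<close> from the end.\<close>
  let ?h = "\<lambda>i. rev cs ! i"
  let ?s = "run_rows add_user ?k 1 (map (\<lambda>u. (budget N u, ?bits u)) us)"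
  let ?valid = "\<lambda>SA. \<forall>u\<in>users N. SA u \<subseteq> {i. i < ?k \<and> ?h i \<in> SpecMap N u} \<and> card (SA u) \<le> budget N u"
  have T: "set_decode (horner (?bits u)) = {i. i < ?k \<and> ?h i \<in> SpecMap N u}" for u
    by (subst set_decode_horner) (auto simp: rev_map split: if_splits)
  have s: "families ?s = {SA ` set us | SA. \<forall>u\<in>set us. SA u \<subseteq> set_decode (horner (?bits u)) \<and>
      card (SA u) \<le> budget N u}" "?s < 2 ^ 2 ^ 2 ^ ?k"
    using families_run_rows[OF us(1), of ?bits ?k "budget N"] by auto
  have "inj_on ?h {..<?k}"
    using cs(1) by (simp add: inj_on_def nth_eq_iff_index_eq)
  moreover have "?h ` {..<?k} = channels N"
    using cs(2) by (metis length_rev lessThan_atLeast0 list.set_map map_nth set_rev set_upt)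
  ultimately have con: "connectable N \<longleftrightarrow> (\<exists>SA. ?valid SA \<and> overlap_connected (users N) SA)"
    using assms(1,2) by (intro connectable_relabel) (auto simp: cognitive_radio_network_def)
  have "connectable N \<longleftrightarrow>
      min (length us) 2 = 1 \<or> min (length us) 2 = 2 \<and> (\<exists>\<A>\<in>families ?s. linked \<A>)"
  proof -
    consider "us = []" | u where "us = [u]" | u v us' where "us = u # v # us'"
      by (metis list.exhaust)
    then show ?thesis
    proof cases
      case 1
      then show ?thesis
        using con us(2) by (simp add: overlap_connected_def)
    next
      case (2 u)
      then have "users N = {u}"
        using us(2) by simp
      \<comment> \<open>A single user reaches itself by the empty path, so the assignment without
        channels will do.\<close>
      then have "?valid (\<lambda>_. {}) \<and> overlap_connected (users N) (\<lambda>_. {} :: nat set)"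
        by (simp add: overlap_connected_def)
      then show ?thesis
        using con 2 by auto
    next
      case (3 u v us')
      then have "overlap_connected (users N) SA \<longleftrightarrow> linked (SA ` users N)" for SA :: "'a \<Rightarrow> nat set"
        using us by (intro overlap_connected_iff_linked[of u _ v]) auto
      then show ?thesis
        unfolding con s(1) T us(2) using 3 by auto
    qed
  qed
  then show ?thesis
    unfolding accept_eq[OF s(2)] by simp
qed

theorem theorem7:
  shows "fixed_parameter_tractable
    {N :: (nat, nat) network. cognitive_radio_network N \<and> complete_potential_graph N}
    connectable encodes_network
    (\<lambda>N. card (channels N)) (\<lambda>N. card (users N))"
proof -
  have "primrec_fun 1 (\<lambda>xs. 2 ^ 2 ^ 2 ^ (xs ! 0))"
    by (intro primrec_power primrec_const primrec_nth) simp
  moreover have "1 < (2 :: nat) ^ 2 ^ 2 ^ k" for k :: nat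
    by (rule one_less_power) simp_all
  ultimately
  obtain P f where f: "computable f" and P: "\<And>k rows w.
      \<forall>(b, bits) \<in> set rows. length bits = k \<and> set bits \<subseteq> {0, 1} \<Longrightarrow>
      outputs_within P (length rows # k # concat (map (\<lambda>(b, bits). b # bits) rows) @ w)
        (f k * max 1 (length rows)) (accept k (run_rows add_user k 1 rows) (min (length rows) 2))"
    using automaton_fpt[OF primrec_add_user primrec_accept _ _ add_user_less] by blast
  \<comment> \<open>The exponent is 1: the user rows are processed in linear time and the adjacency
    matrix is the tail left on the tape.\<close>
  have "outputs_within P w (f (card (channels N)) * max 1 (card (users N)) ^ 1) (if connectable N then 1 else 0)"
    if N: "cognitive_radio_network N" "complete_potential_graph N" and "encodes_network N w"
    for N :: "(nat, nat) network" and w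
  proof -
    obtain us cs where us: "distinct us" "set us = users N" and cs: "distinct cs" "set cs = channels N"
      and w: "w = network_code us cs N"
      using \<open>encodes_network N w\<close> unfolding encodes_network_def by blast
    let ?rows = "map (\<lambda>u. (budget N u, map (\<lambda>c. if c \<in> SpecMap N u then 1 else 0) cs)) us"
    let ?adj = "concat (map (\<lambda>u. map (\<lambda>v. if (u, v) \<in> parcs (PG N) then 1 else 0) us) us)"
    have len: "length us = card (users N)" "length cs = card (channels N)"
      using us cs distinct_card by metis+
    have w': "w = length ?rows # length cs # concat (map (\<lambda>(b, bits). b # bits) ?rows) @ ?adj"
      by (simp add: w network_code_def o_def)
    have rows: "\<forall>(b, bits) \<in> set ?rows. length bits = length cs \<and> set bits \<subseteq> {0, 1}"
      by auto
    show ?thesis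
      using P[OF rows, of ?adj] unfolding w'[symmetric] unfolding length_map accept_network[OF N us cs]
      by (simp only: len power_one_right)
  qed
  then show ?thesis
    unfolding fixed_parameter_tractable_def using f by blast
qed

end
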